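(* Let $E$ be a finite directed graph without sources, let $(G,E)$ be a faithful self-similar groupoid action, and let $(u,p,s)$ be the generating family of the Toeplitz algebra $\mathcal{T}(G,E)$. Then $$\mathcal{T}(G,E)=\overline{\operatorname{span}}\{s_\mu u_gs_\nu^*:\mu,\nu\in E^*,\ g\in G\text{ and }s(\mu)=g\cdot s(\nu)\}.$$
   Context: Graphs: for a directed graph $E=(E^0,E^1,r,s)$, $E^k$ is the set of paths $\mu=\mu_1\cdots\mu_k$ with $s(\mu_i)=r(\mu_{i+1})$; $r(\mu)=r(\mu_1)$, $s(\mu)=s(\mu_k)$; vertices are paths of length $0$ with $r(v)=s(v)=v$; $E^*=\bigsqcup_{k\ge0}E^k$; $vE^k=\{\mu\in E^k:r(\mu)=v\}$, $vE^*=\bigsqcup_kvE^k$. "Without sources" means $vE^1\ne\emptyset$ for all $v$. Groupoids and self-similar actions: a groupoid $G$ with unit space $G^0$ is a small category with inverses, with domain and codomain maps $d,c:G\to G^0$, product $gh$ defined when $d(g)=c(h)$; it is discrete and units are identified with identity morphisms. A partial isomorphism of $E^*$ is a bijection $g:vE^*\to wE^*$ that maps $vE^k$ bijectively onto $wE^k$ for all $k\ge0$ and satisfies $g(\mu e)\in g(\mu)E^1$ for $\mu e\in vE^*$, $e\in E^1$; under composition these form a groupoid $\mathrm{PIso}(E^* )$ with unit space $E^0$ ($d(g)=v$, $c(g)=w$). A (faithful) self-similar groupoid action $(G,E)$ is a groupoid $G$ with unit space $E^0$ and an injective unit-preserving homomorphism $G\to\mathrm{PIso}(E^* )$, written $g\cdot\mu$,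 such that for all $g\in G$, $e\in d(g)E^1$ there is a (unique) $g|_e\in G$ with $g\cdot(e\mu)=(g\cdot e)(g|_e\cdot\mu)$ for all $\mu\in s(e)E^*$. The condition $s(\mu)=g\cdot s(\nu)$ means $d(g)=s(\nu)$ and $c(g)=s(\mu)$. Algebras: a unitary representation $U$ of $G$ in a $C^*$-algebra assigns to each $v\in G^0$ a projection $U_v$ and to each $g$ a partial isometry $U_g$ with initial projection $U_{d(g)}$ and final projection $U_{c(g)}$, with $U_gU_h=U_{gh}$ if $d(g)=c(h)$ and $0$ otherwise. A Toeplitz-Cuntz-Krieger $E$-family $(p,s)$ consists of mutually orthogonal projections $p_v$ and partial isometries $s_e$ with $s_e^*s_e=p_{s(e)}$ and $p_v\ge\sum_{e\in vE^1}s_es_e^*$. $\mathcal{T}(G,E)$ is the universal unital $C^*$-algebra generated by a unitary representation $u$ of $G$ and a Toeplitz-Cuntz-Krieger $E$-family $(p,s)$ with $u_v=p_v$, $\sum_vp_v=1$, and $u_gs_e=s_{g\cdot e}u_{g|_e}$ if $d(g)=r(e)$, $u_gs_e=0$ otherwise. Write $s_\mu=s_{\mu_1}\cdots s_{\mu_k}$ for $\mu=\mu_1\cdots\mu_k$ and $s_v=p_v$. *)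

theory Defs
  imports "HOL-Analysis.Analysis" "HOL-Algebra.Algebra" "HOL-Algebra.Algebraic_Closure_Type"
    "Graph_Theory.Digraph"
begin

section \<open>Paths in a directed graph\<close>

text \<open>
  A path \<open>\<mu> = e\<^sub>1 \<dots> e\<^sub>k\<close> is encoded as the pair \<open>(r(\<mu>), [e\<^sub>1, \<dots>, e\<^sub>k])\<close>, so that the vertex \<open>v\<close>, as a
  path of length 0, is \<open>(v, [])\<close>. The source of an edge is its \<^const>\<open>tail\<close> and its range is its
  \<^const>\<open>head\<close>; paths are composable in the order of maps, \<open>s(e\<^sub>i) = r(e\<^sub>i\<^sub>+\<^sub>1)\<close>, which is the reverse of
  the walks of Graph_Theory.
\<close>

type_synonym ('v, 'e) path = "'v \<times> 'e list"

definition paths :: "('v, 'e) pre_digraph \<Rightarrow> ('v, 'e) path set" where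
  "paths E = {(v, es). v \<in> verts E \<and> set es \<subseteq> arcs E
     \<and> successively (\<lambda>e f. tail E e = head E f) es
     \<and> (es \<noteq> [] \<longrightarrow> head E (hd es) = v)}"

definition prange :: "('v, 'e) path \<Rightarrow> 'v" where
  "prange \<mu> = fst \<mu>"

definition psource :: "('v, 'e) pre_digraph \<Rightarrow> ('v, 'e) path \<Rightarrow> 'v" where
  "psource E \<mu> = (if snd \<mu> = [] then fst \<mu> else tail E (last (snd \<mu>)))"

definition plength :: "('v, 'e) path \<Rightarrow> nat" where
  "plength \<mu> = length (snd \<mu>)"

definition vpath :: "'v \<Rightarrow> ('v, 'e) path" where
  "vpath v = (v, [])"

definition epath :: "('v, 'e) pre_digraph \<Rightarrow> 'e \<Rightarrow> ('v, 'e) path" where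
  "epath E e = (head E e, [e])"

text \<open>Only meaningful if \<open>psource E \<mu> = prange \<nu>\<close>.\<close>
definition pcat :: "('v, 'e) path \<Rightarrow> ('v, 'e) path \<Rightarrow> ('v, 'e) path" where
  "pcat \<mu> \<nu> = (fst \<mu>, snd \<mu> @ snd \<nu>)"

text \<open>\<open>vE\<^sup>*\<close> and \<open>vE\<^sup>k\<close>; the set \<open>vE\<^sup>1\<close> of edges is \<^term>\<open>in_arcs E v\<close>.\<close>
definition paths_at :: "('v, 'e) pre_digraph \<Rightarrow> 'v \<Rightarrow> ('v, 'e) path set" where
  "paths_at E v = {\<mu> \<in> paths E. prange \<mu> = v}"

definition paths_at_len :: "('v, 'e) pre_digraph \<Rightarrow> 'v \<Rightarrow> nat \<Rightarrow> ('v, 'e) path set" where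
  "paths_at_len E v k = {\<mu> \<in> paths_at E v. plength \<mu> = k}"

definition without_sources :: "('v, 'e) pre_digraph \<Rightarrow> bool" where
  "without_sources E \<longleftrightarrow> (\<forall>v \<in> verts E. in_arcs E v \<noteq> {})"


section \<open>Groupoids\<close>

text \<open>A unit \<open>v\<close> is identified with its identity morphism \<open>gid G v\<close>.\<close>

record ('v, 'g) groupoid =
  objs :: "'v set"
  arrs :: "'g set"
  gdom :: "'g \<Rightarrow> 'v"
  gcod :: "'g \<Rightarrow> 'v"
  gcomp :: "'g \<Rightarrow> 'g \<Rightarrow> 'g"
  gid :: "'v \<Rightarrow> 'g"

locale groupoid =
  fixes G :: "('v, 'g) groupoid"
  assumes dom_in: "g \<in> arrs G \<Longrightarrow> gdom G g \<in> objs G"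
    and cod_in: "g \<in> arrs G \<Longrightarrow> gcod G g \<in> objs G"
    and comp_in: "\<lbrakk>g \<in> arrs G; h \<in> arrs G; gdom G g = gcod G h\<rbrakk> \<Longrightarrow> gcomp G g h \<in> arrs G"
    and dom_comp: "\<lbrakk>g \<in> arrs G; h \<in> arrs G; gdom G g = gcod G h\<rbrakk>
      \<Longrightarrow> gdom G (gcomp G g h) = gdom G h"
    and cod_comp: "\<lbrakk>g \<in> arrs G; h \<in> arrs G; gdom G g = gcod G h\<rbrakk>
      \<Longrightarrow> gcod G (gcomp G g h) = gcod G g"
    and comp_assoc: "\<lbrakk>g \<in> arrs G; h \<in> arrs G; k \<in> arrs G; gdom G g = gcod G h; gdom G h = gcod G k\<rbrakk>
      \<Longrightarrow> gcomp G (gcomp G g h) k = gcomp G g (gcomp G h k)"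
    and id_in: "v \<in> objs G \<Longrightarrow> gid G v \<in> arrs G"
    and dom_id: "v \<in> objs G \<Longrightarrow> gdom G (gid G v) = v"
    and cod_id: "v \<in> objs G \<Longrightarrow> gcod G (gid G v) = v"
    and id_right: "g \<in> arrs G \<Longrightarrow> gcomp G g (gid G (gdom G g)) = g"
    and id_left: "g \<in> arrs G \<Longrightarrow> gcomp G (gid G (gcod G g)) g = g"
    and inverses: "g \<in> arrs G \<Longrightarrow> \<exists>h \<in> arrs G. gdom G h = gcod G g \<and> gcod G h = gdom G g
      \<and> gcomp G h g = gid G (gdom G g) \<and> gcomp G g h = gid G (gcod G g)"

text \<open>Unit-preserving homomorphisms between groupoids with the same unit space.\<close>
definition unit_preserving_hom ::
    "('v, 'g) groupoid \<Rightarrow> ('v, 'h) groupoid \<Rightarrow> ('g \<Rightarrow> 'h) \<Rightarrow> bool" where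
  "unit_preserving_hom G H \<phi> \<longleftrightarrow> objs G = objs H \<and>
     (\<forall>g \<in> arrs G. \<phi> g \<in> arrs H \<and> gdom H (\<phi> g) = gdom G g \<and> gcod H (\<phi> g) = gcod G g) \<and>
     (\<forall>v \<in> objs G. \<phi> (gid G v) = gid H v) \<and>
     (\<forall>g \<in> arrs G. \<forall>h \<in> arrs G. gdom G g = gcod G h \<longrightarrow>
        \<phi> (gcomp G g h) = gcomp H (\<phi> g) (\<phi> h))"


section \<open>Partial isomorphisms and self-similar actions\<close>

text \<open>The map of a partial isomorphism is \<^const>\<open>undefined\<close> off its domain \<open>vE\<^sup>*\<close>, so that equality
  of records is equality of partial isomorphisms.\<close>

record ('v, 'e) piso =
  pdom :: 'v
  pcod :: 'v
  pmap :: "('v, 'e) path \<Rightarrow> ('v, 'e) path"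

definition is_piso :: "('v, 'e) pre_digraph \<Rightarrow> ('v, 'e) piso \<Rightarrow> bool" where
  "is_piso E g \<longleftrightarrow> pdom g \<in> verts E \<and> pcod g \<in> verts E \<and>
     pmap g \<in> extensional (paths_at E (pdom g)) \<and>
     bij_betw (pmap g) (paths_at E (pdom g)) (paths_at E (pcod g)) \<and>
     (\<forall>k. bij_betw (pmap g) (paths_at_len E (pdom g) k) (paths_at_len E (pcod g) k)) \<and>
     (\<forall>\<mu> \<in> paths_at E (pdom g). \<forall>e \<in> in_arcs E (psource E \<mu>).
        \<exists>f \<in> in_arcs E (psource E (pmap g \<mu>)).
          pmap g (pcat \<mu> (epath E e)) = pcat (pmap g \<mu>) (epath E f))"

definition PIso :: "('v, 'e) pre_digraph \<Rightarrow> ('v, ('v, 'e) piso) groupoid" where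
  "PIso E = \<lparr> objs = verts E, arrs = {g. is_piso E g}, gdom = pdom, gcod = pcod,
     gcomp = (\<lambda>g h. \<lparr> pdom = pdom h, pcod = pcod g,
        pmap = compose (paths_at E (pdom h)) (pmap g) (pmap h) \<rparr>),
     gid = (\<lambda>v. \<lparr> pdom = v, pcod = v, pmap = restrict id (paths_at E v) \<rparr>) \<rparr>"

text \<open>\<open>g \<cdot> \<mu>\<close>, and \<open>g \<cdot> e\<close> as an edge, for a homomorphism \<open>\<phi>\<close> into \<^term>\<open>PIso E\<close>.\<close>
definition act :: "('g \<Rightarrow> ('v, 'e) piso) \<Rightarrow> 'g \<Rightarrow> ('v, 'e) path \<Rightarrow> ('v, 'e) path" where
  "act \<phi> g \<mu> = pmap (\<phi> g) \<mu>"

definition act_edge :: "('v, 'e) pre_digraph \<Rightarrow> ('g \<Rightarrow> ('v, 'e) piso) \<Rightarrow> 'g \<Rightarrow> 'e \<Rightarrow> 'e" where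
  "act_edge E \<phi> g e = hd (snd (act \<phi> g (epath E e)))"

text \<open>The conditions on \<open>d(h)\<close> and \<open>c(h)\<close> say that \<open>h \<cdot> \<mu>\<close> and \<open>(g \<cdot> e)(h \<cdot> \<mu>)\<close> make sense.\<close>
definition is_restriction :: "('v, 'e) pre_digraph \<Rightarrow> ('v, 'g) groupoid \<Rightarrow>
    ('g \<Rightarrow> ('v, 'e) piso) \<Rightarrow> 'g \<Rightarrow> 'e \<Rightarrow> 'g \<Rightarrow> bool" where
  "is_restriction E G \<phi> g e h \<longleftrightarrow> h \<in> arrs G \<and> gdom G h = tail E e \<and>
     gcod G h = psource E (act \<phi> g (epath E e)) \<and>
     (\<forall>\<mu> \<in> paths_at E (tail E e).
        act \<phi> g (pcat (epath E e) \<mu>) = pcat (act \<phi> g (epath E e)) (act \<phi> h \<mu>))"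

locale faithful_self_similar_action = wf_digraph E + groupoid G
  for E :: "('v, 'e) pre_digraph" and G :: "('v, 'g) groupoid" +
  fixes \<phi> :: "'g \<Rightarrow> ('v, 'e) piso"
  assumes unit_space: "objs G = verts E"
    and hom: "unit_preserving_hom G (PIso E) \<phi>"
    and faithful: "inj_on \<phi> (arrs G)"
    and self_similar: "\<lbrakk>g \<in> arrs G; e \<in> in_arcs E (gdom G g)\<rbrakk>
      \<Longrightarrow> \<exists>h. is_restriction E G \<phi> g e h"

text \<open>\<open>g|\<^sub>e\<close>, which is well defined by the lemma that follows.\<close>
definition restriction :: "('v, 'e) pre_digraph \<Rightarrow> ('v, 'g) groupoid \<Rightarrow>
    ('g \<Rightarrow> ('v, 'e) piso) \<Rightarrow> 'g \<Rightarrow> 'e \<Rightarrow> 'g" where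
  "restriction E G \<phi> g e = (THE h. is_restriction E G \<phi> g e h)"

lemma (in faithful_self_similar_action) restriction_unique:
  assumes "is_restriction E G \<phi> g e h" "is_restriction E G \<phi> g e h'"
  shows "h = h'"
proof -
  have arr: "h \<in> arrs G" "h' \<in> arrs G"
    using assms by (auto simp: is_restriction_def)
  have d: "pdom (\<phi> h) = tail E e" "pdom (\<phi> h') = tail E e" "pcod (\<phi> h) = pcod (\<phi> h')"
    and P: "is_piso E (\<phi> h)" "is_piso E (\<phi> h')"
    using assms hom by (auto simp: is_restriction_def unit_preserving_hom_def PIso_def)
  have "pmap (\<phi> h) = pmap (\<phi> h')"
  proof (rule extensionalityI)
    fix \<mu> assume \<mu>: "\<mu> \<in> paths_at E (tail E e)"
    have "snd (pmap (\<phi> h) \<mu>) = snd (pmap (\<phi> h') \<mu>)"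
      using assms \<mu> by (auto simp: is_restriction_def act_def pcat_def)
    moreover have "pmap (\<phi> h) \<mu> \<in> paths_at E (pcod (\<phi> h))" "pmap (\<phi> h') \<mu> \<in> paths_at E (pcod (\<phi> h))"
      using P d \<mu> unfolding is_piso_def by (metis bij_betwE)+
    ultimately show "pmap (\<phi> h) \<mu> = pmap (\<phi> h') \<mu>"
      by (auto simp: paths_at_def prange_def prod_eq_iff)
  qed (use P d in \<open>auto simp: is_piso_def\<close>)
  then have "\<phi> h = \<phi> h'" using d by (intro piso.equality) auto
  with faithful arr show ?thesis by (auto dest: inj_onD)
qed


section \<open>Unital C*-algebras\<close>

record 'a cstar_alg = "(complex, 'a) module" +
  adj :: "'a \<Rightarrow> 'a"
  nrm :: "'a \<Rightarrow> real"

text \<open>The value off the carrier only serves to make this total function a metric in the sense of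
  \<^locale>\<open>Metric_space\<close>.\<close>
definition cstar_dist :: "('a, 'm) cstar_alg_scheme \<Rightarrow> 'a \<Rightarrow> 'a \<Rightarrow> real" where
  "cstar_dist A x y = (if x \<in> carrier A \<and> y \<in> carrier A then nrm A (x \<ominus>\<^bsub>A\<^esub> y) else 0)"

definition cstar_topology :: "('a, 'm) cstar_alg_scheme \<Rightarrow> 'a topology" where
  "cstar_topology A = Metric_space.mtopology (carrier A) (cstar_dist A)"

text \<open>The zero algebra, in which \<open>\<one> = \<zero>\<close>, is allowed.\<close>
locale cstar_algebra = ring A + module "ring_of_type_algebra :: complex ring" A
  for A :: "'a cstar_alg" (structure) +
  assumes smult_mult_left: "\<lbrakk>x \<in> carrier A; y \<in> carrier A\<rbrakk> \<Longrightarrow> (c \<odot> x) \<otimes> y = c \<odot> (x \<otimes> y)"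
    and smult_mult_right: "\<lbrakk>x \<in> carrier A; y \<in> carrier A\<rbrakk> \<Longrightarrow> x \<otimes> (c \<odot> y) = c \<odot> (x \<otimes> y)"
    and adj_closed: "x \<in> carrier A \<Longrightarrow> adj A x \<in> carrier A"
    and adj_adj: "x \<in> carrier A \<Longrightarrow> adj A (adj A x) = x"
    and adj_add: "\<lbrakk>x \<in> carrier A; y \<in> carrier A\<rbrakk> \<Longrightarrow> adj A (x \<oplus> y) = adj A x \<oplus> adj A y"
    and adj_smult: "x \<in> carrier A \<Longrightarrow> adj A (c \<odot> x) = cnj c \<odot> adj A x"
    and adj_mult: "\<lbrakk>x \<in> carrier A; y \<in> carrier A\<rbrakk> \<Longrightarrow> adj A (x \<otimes> y) = adj A y \<otimes> adj A x"
    and nrm_nonneg: "x \<in> carrier A \<Longrightarrow> 0 \<le> nrm A x"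
    and nrm_eq_zero: "x \<in> carrier A \<Longrightarrow> nrm A x = 0 \<longleftrightarrow> x = \<zero>"
    and nrm_triangle: "\<lbrakk>x \<in> carrier A; y \<in> carrier A\<rbrakk> \<Longrightarrow> nrm A (x \<oplus> y) \<le> nrm A x + nrm A y"
    and nrm_smult: "x \<in> carrier A \<Longrightarrow> nrm A (c \<odot> x) = cmod c * nrm A x"
    and nrm_mult: "\<lbrakk>x \<in> carrier A; y \<in> carrier A\<rbrakk> \<Longrightarrow> nrm A (x \<otimes> y) \<le> nrm A x * nrm A y"
    and nrm_cstar: "x \<in> carrier A \<Longrightarrow> nrm A (adj A x \<otimes> x) = (nrm A x)\<^sup>2"
    and nrm_complete: "Metric_space.mcomplete (carrier A) (cstar_dist A)"

definition cspan :: "'a cstar_alg \<Rightarrow> 'a set \<Rightarrow> 'a set" where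
  "cspan A S = {\<Oplus>\<^bsub>A\<^esub>x\<in>F. c x \<odot>\<^bsub>A\<^esub> x | F c. finite F \<and> F \<subseteq> S}"

definition closed_cspan :: "'a cstar_alg \<Rightarrow> 'a set \<Rightarrow> 'a set" where
  "closed_cspan A S = cstar_topology A closure_of cspan A S"

definition cstar_subalgebra :: "'a set \<Rightarrow> 'a cstar_alg \<Rightarrow> bool" where
  "cstar_subalgebra B A \<longleftrightarrow> subring B A \<and> (\<forall>c. \<forall>x \<in> B. c \<odot>\<^bsub>A\<^esub> x \<in> B) \<and>
     (\<forall>x \<in> B. adj A x \<in> B) \<and> closedin (cstar_topology A) B"

definition cstar_generated_by :: "'a cstar_alg \<Rightarrow> 'a set \<Rightarrow> bool" where
  "cstar_generated_by A S \<longleftrightarrow> S \<subseteq> carrier A \<and>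
     (\<forall>B. cstar_subalgebra B A \<longrightarrow> S \<subseteq> B \<longrightarrow> B = carrier A)"

definition unital_star_hom :: "'a cstar_alg \<Rightarrow> 'b cstar_alg \<Rightarrow> ('a \<Rightarrow> 'b) \<Rightarrow> bool" where
  "unital_star_hom A B \<psi> \<longleftrightarrow> \<psi> \<in> ring_hom A B \<and>
     (\<forall>c. \<forall>x \<in> carrier A. \<psi> (c \<odot>\<^bsub>A\<^esub> x) = c \<odot>\<^bsub>B\<^esub> \<psi> x) \<and>
     (\<forall>x \<in> carrier A. \<psi> (adj A x) = adj B (\<psi> x))"

definition projection :: "'a cstar_alg \<Rightarrow> 'a \<Rightarrow> bool" where
  "projection A x \<longleftrightarrow> x \<in> carrier A \<and> adj A x = x \<and> x \<otimes>\<^bsub>A\<^esub> x = x"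

definition partial_isometry :: "'a cstar_alg \<Rightarrow> 'a \<Rightarrow> bool" where
  "partial_isometry A x \<longleftrightarrow> x \<in> carrier A \<and> x \<otimes>\<^bsub>A\<^esub> adj A x \<otimes>\<^bsub>A\<^esub> x = x"

text \<open>The order on self-adjoint elements; the positive elements are those of the form \<open>z\<^sup>* z\<close>.\<close>
definition cstar_le :: "'a cstar_alg \<Rightarrow> 'a \<Rightarrow> 'a \<Rightarrow> bool" where
  "cstar_le A x y \<longleftrightarrow> x \<in> carrier A \<and> y \<in> carrier A \<and> adj A x = x \<and> adj A y = y \<and>
     (\<exists>z \<in> carrier A. y \<ominus>\<^bsub>A\<^esub> x = adj A z \<otimes>\<^bsub>A\<^esub> z)"


section \<open>The Toeplitz algebra of a self-similar groupoid action\<close>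

definition unitary_representation :: "('v, 'g) groupoid \<Rightarrow> 'a cstar_alg \<Rightarrow> ('g \<Rightarrow> 'a) \<Rightarrow> bool" where
  "unitary_representation G A u \<longleftrightarrow>
     (\<forall>v \<in> objs G. projection A (u (gid G v))) \<and>
     (\<forall>g \<in> arrs G. partial_isometry A (u g) \<and>
        adj A (u g) \<otimes>\<^bsub>A\<^esub> u g = u (gid G (gdom G g)) \<and>
        u g \<otimes>\<^bsub>A\<^esub> adj A (u g) = u (gid G (gcod G g))) \<and>
     (\<forall>g \<in> arrs G. \<forall>h \<in> arrs G.
        u g \<otimes>\<^bsub>A\<^esub> u h = (if gdom G g = gcod G h then u (gcomp G g h) else \<zero>\<^bsub>A\<^esub>))"

definition toeplitz_CK_family ::
    "('v, 'e) pre_digraph \<Rightarrow> 'a cstar_alg \<Rightarrow> ('v \<Rightarrow> 'a) \<Rightarrow> ('e \<Rightarrow> 'a) \<Rightarrow> bool" where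
  "toeplitz_CK_family E A p s \<longleftrightarrow>
     (\<forall>v \<in> verts E. projection A (p v)) \<and>
     (\<forall>v \<in> verts E. \<forall>w \<in> verts E. v \<noteq> w \<longrightarrow> p v \<otimes>\<^bsub>A\<^esub> p w = \<zero>\<^bsub>A\<^esub>) \<and>
     (\<forall>e \<in> arcs E. partial_isometry A (s e) \<and> adj A (s e) \<otimes>\<^bsub>A\<^esub> s e = p (tail E e)) \<and>
     (\<forall>v \<in> verts E. cstar_le A (\<Oplus>\<^bsub>A\<^esub>e\<in>in_arcs E v. s e \<otimes>\<^bsub>A\<^esub> adj A (s e)) (p v))"

definition toeplitz_family :: "('v, 'e) pre_digraph \<Rightarrow> ('v, 'g) groupoid \<Rightarrow>
    ('g \<Rightarrow> ('v, 'e) piso) \<Rightarrow> 'a cstar_alg \<Rightarrow> ('g \<Rightarrow> 'a) \<Rightarrow> ('v \<Rightarrow> 'a) \<Rightarrow> ('e \<Rightarrow> 'a) \<Rightarrow> bool" where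
  "toeplitz_family E G \<phi> A u p s \<longleftrightarrow>
     unitary_representation G A u \<and> toeplitz_CK_family E A p s \<and>
     (\<forall>v \<in> verts E. u (gid G v) = p v) \<and>
     (\<Oplus>\<^bsub>A\<^esub>v\<in>verts E. p v) = \<one>\<^bsub>A\<^esub> \<and>
     (\<forall>g \<in> arrs G. \<forall>e \<in> arcs E. u g \<otimes>\<^bsub>A\<^esub> s e =
        (if gdom G g = head E e
         then s (act_edge E \<phi> g e) \<otimes>\<^bsub>A\<^esub> u (restriction E G \<phi> g e) else \<zero>\<^bsub>A\<^esub>))"

text \<open>
  \<open>A\<close>, with the family \<open>(u, p, s)\<close>, is the universal unital C*-algebra generated by a family
  with the above relations. HOL cannot quantify over the carrier type of the test algebra \<open>B\<close>, but
  for finite \<open>E\<close> and a faithful action nothing is lost by taking \<open>B\<close> with carrier a set of reals: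
  \<open>E\<^sup>*\<close> is then countable and \<open>G\<close> embeds into \<open>PIso(E\<^sup>*)\<close>, so there are at most continuum many
  generators; hence every C*-algebra generated by such a family has at most the cardinality of the
  continuum, and is isomorphic to one carried by a set of reals.
\<close>
definition toeplitz_algebra :: "('v, 'e) pre_digraph \<Rightarrow> ('v, 'g) groupoid \<Rightarrow>
    ('g \<Rightarrow> ('v, 'e) piso) \<Rightarrow> 'a cstar_alg \<Rightarrow> ('g \<Rightarrow> 'a) \<Rightarrow> ('v \<Rightarrow> 'a) \<Rightarrow> ('e \<Rightarrow> 'a) \<Rightarrow> bool" where
  "toeplitz_algebra E G \<phi> A u p s \<longleftrightarrow>
     cstar_algebra A \<and> toeplitz_family E G \<phi> A u p s \<and>
     cstar_generated_by A (u ` arrs G \<union> p ` verts E \<union> s ` arcs E) \<and>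
     (\<forall>(B :: real cstar_alg) u' p' s'. cstar_algebra B \<longrightarrow> toeplitz_family E G \<phi> B u' p' s' \<longrightarrow>
        (\<exists>\<psi>. unital_star_hom A B \<psi> \<and> (\<forall>g \<in> arrs G. \<psi> (u g) = u' g) \<and>
           (\<forall>v \<in> verts E. \<psi> (p v) = p' v) \<and> (\<forall>e \<in> arcs E. \<psi> (s e) = s' e)))"

text \<open>\<open>s\<^sub>\<mu>\<close>\<close>
definition s_path :: "'a cstar_alg \<Rightarrow> ('v \<Rightarrow> 'a) \<Rightarrow> ('e \<Rightarrow> 'a) \<Rightarrow> ('v, 'e) path \<Rightarrow> 'a" where
  "s_path A p s \<mu> = (if snd \<mu> = [] then p (fst \<mu>)
     else foldr (\<lambda>e x. s e \<otimes>\<^bsub>A\<^esub> x) (snd \<mu>) \<one>\<^bsub>A\<^esub>)"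

end

theory Submission
  imports Defs
begin

text \<open>
  The products of two spanning elements are again spanning elements or zero, provided that
  \<open>s\<^sub>e\<^sup>* s\<^sub>f = 0\<close> for \<open>e \<noteq> f\<close>; so the span is a unital *-algebra containing the generators, and its
  closure is everything. For edges with different ranges the orthogonality follows from
  \<open>s\<^sub>e = p\<^bsub>r(e)\<^esub> s\<^sub>e\<close>, a consequence of \<open>\<Sum>\<^sub>v p\<^sub>v = 1\<close>. For edges with the same range it comes from the
  inequality \<open>\<Sum>\<^sub>e s\<^sub>e s\<^sub>e\<^sup>* \<le> p\<^sub>v\<close>, which only says that the difference is of the form \<open>z\<^sup>* z\<close>. Compressing
  by one of the range projections \<open>r\<close> leads to equations \<open>y\<^sup>* y = - r S r\<close> with \<open>S\<close> a sum of other
  range projections, and one needs a case of the theorem that \<open>y\<^sup>* y\<close> is positive. It is proved without functional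
  calculus: call \<open>a = a\<^sup>*\<close> positive if \<open>\<parallel>1 - \<epsilon>a\<parallel> \<le> 1 + O(\<epsilon>\<^sup>2)\<close> for \<open>\<epsilon> \<ge> 0\<close>. Kaplansky's trick, with
  \<open>y y\<^sup>* + y\<^sup>* y\<close> a sum of two squares, bounds \<open>1 \<plusminus> \<epsilon>b\<close> for \<open>b = y\<^sup>* y\<close> on the ideal generated by \<open>b\<close>, and a
  Liouville type argument gives \<open>b = 0\<close>.
\<close>

section \<open>C*-seminorms on complex polynomials\<close>

text \<open>Taking \<open>2 ^ k\<close>-th roots makes the constant \<open>K\<close> disappear: if
  \<open>a / D > 1\<close>, the powers of \<open>a / D\<close> would be unbounded. Exponents
  \<open>2 ^ k\<close> suffice, and they are the ones that repeated squaring with the C*-identity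
  produces.\<close>

lemma le_of_dyadic_powers_le:
  fixes a K D :: real
  assumes D: "D > 0" and le: "\<And>k. a ^ 2 ^ k \<le> K * D ^ 2 ^ k"
  shows "a \<le> D"
proof (rule ccontr)
  assume "\<not> a \<le> D"
  then have gt: "1 < a / D" using D by simp
  obtain n where n: "K < (a / D) ^ n" using real_arch_pow[OF gt] by blast
  have "n \<le> 2 ^ n" using less_exp[of n] by simp
  then have "(a / D) ^ n \<le> (a / D) ^ 2 ^ n" using gt by (intro power_increasing) auto
  also have "\<dots> \<le> K" using le[of n] D by (simp add: power_divide field_simps)
  finally show False using n by simp
qed

lemma map_poly_cnj_mult: "map_poly cnj (f * g) = map_poly cnj f * map_poly cnj g"
  by (intro Polynomial.poly_eqI) (simp add: coeff_map_poly coeff_mult)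

lemma map_poly_cnj_power: "map_poly cnj (f ^ n) = map_poly cnj f ^ n"
  by (induction n) (simp_all add: map_poly_cnj_mult)

lemma map_poly_cnj_pCons: "map_poly cnj (pCons a f) = pCons (cnj a) (map_poly cnj f)"
  by (simp add: map_poly_pCons)

text \<open>Models \<open>f \<mapsto> \<parallel>f(x)\<parallel>\<close> for a self-adjoint element
  \<open>x\<close> of a C*-algebra. As \<open>x\<close> is self-adjoint, the adjoint of
  \<open>f(x)\<close> arises by conjugating the coefficients of \<open>f\<close>. Only
  \<open>M 1 \<le> 1\<close> is asked, which admits the zero algebra.\<close>

locale poly_cstar_seminorm =
  fixes M :: "complex Polynomial.poly \<Rightarrow> real"
  assumes M_nonneg: "0 \<le> M f"
    and M_add: "M (f + g) \<le> M f + M g"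
    and M_smult: "M (Polynomial.smult c f) = cmod c * M f"
    and M_mult: "M (f * g) \<le> M f * M g"
    and M_one: "M 1 \<le> 1"
    and M_star: "M (map_poly cnj f * f) = (M f)\<^sup>2"
begin

lemma M_minus: "M (f - g) \<le> M f + M g"
  using M_add[of f "- g"] M_smult[of "-1" g] by simp

lemma M_cnj: "M (map_poly cnj f) = M f"
proof -
  have le: "M f \<le> M (map_poly cnj f)" for f
  proof (cases "M f = 0")
    case False
    then have "M f > 0" using M_nonneg[of f] by simp
    moreover have "M f * M f \<le> M (map_poly cnj f) * M f"
      using M_mult[of "map_poly cnj f" f] by (simp add: M_star power2_eq_square)
    ultimately show ?thesis by simp
  qed (simp add: M_nonneg)
  have "map_poly cnj (map_poly cnj f) = f"
    by (intro Polynomial.poly_eqI) (simp add: coeff_map_poly)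
  then show ?thesis using le[of f] le[of "map_poly cnj f"] by simp
qed

text \<open>For \<open>f\<close> with real coefficients the C*-identity reads
  \<open>M (f * f) = (M f)\<^sup>2\<close>, and squaring can be iterated.\<close>

lemma M_real_power: 
  assumes "map_poly cnj f = f"
  shows "M (f ^ 2 ^ k) = M f ^ 2 ^ k"
proof (induction k)
  case (Suc k)
  have "map_poly cnj (f ^ 2 ^ k) = f ^ 2 ^ k"
    by (simp add: assms map_poly_cnj_power)
  then have "M (f ^ 2 ^ k * f ^ 2 ^ k) = (M (f ^ 2 ^ k))\<^sup>2"
    using M_star[of "f ^ 2 ^ k"] by simp
  then show ?case
    by (simp add: Suc power2_eq_square mult_2 power_add)
qed simp

text \<open>The polynomial \<open>1 - e X\<^sup>2\<close> is the average of the two polynomials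
  \<open>F = 1 \<plusminus> \<i> s X - e X\<^sup>2\<close>. With \<open>s\<^sup>2 = 2 e\<close> the
  quadratic terms of \<open>F* F\<close> cancel and leave \<open>1 + e\<^sup>2 X\<^sup>4\<close>, so
  the C*-identity bounds \<open>M F\<close> to second order in \<open>e\<close>.\<close>

lemma M_square_nearly_contractive:
  "\<exists>C\<ge>0. \<forall>e\<ge>0. M [:1, 0, - complex_of_real e:] \<le> 1 + C * e\<^sup>2"
proof (intro exI conjI allI impI)
  let ?C = "M [:0,0,0,0,1:]"
  show C: "0 \<le> ?C" by (rule M_nonneg)
  fix e :: real assume e: "0 \<le> e"
  define s where "s = sqrt (2 * e)"
  have s2: "s * s = 2 * e" using e by (simp add: s_def)
  have s2': "complex_of_real s * complex_of_real s = 2 * complex_of_real e"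
    using s2 by (metis of_real_mult of_real_numeral)
  have bound: "M [:1, c * s, - complex_of_real e:] \<le> 1 + ?C * e\<^sup>2" if c: "c = \<i> \<or> c = -\<i>" for c
  proof -
    let ?F = "[:1, c * s, - complex_of_real e:]"
    have "map_poly cnj ?F * ?F = 1 + Polynomial.smult ((complex_of_real e)\<^sup>2) [:0,0,0,0,1:]"
      using c s2' by (auto simp: map_poly_cnj_pCons one_pCons power2_eq_square algebra_simps)
    then have "(M ?F)\<^sup>2 \<le> 1 + e\<^sup>2 * ?C"
      using M_add[of 1 "Polynomial.smult ((complex_of_real e)\<^sup>2) [:0,0,0,0,1:]"] M_one M_star[of ?F]
        M_smult[of "(complex_of_real e)\<^sup>2" "[:0,0,0,0,1:]"]
      by (simp add: norm_power)
    also have "\<dots> \<le> (1 + ?C * e\<^sup>2)\<^sup>2"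
    proof -
      have "0 \<le> ?C * e\<^sup>2" using C by simp
      then show ?thesis by (simp only: power2_sum) (simp add: mult.commute)
    qed
    finally show ?thesis by (rule power2_le_imp_le) (simp add: C)
  qed
  have "[:1, 0, - complex_of_real e:]
      = Polynomial.smult (1/2) ([:1, \<i> * s, - complex_of_real e:] + [:1, -\<i> * s, - complex_of_real e:])"
    by simp
  then have "M [:1, 0, - complex_of_real e:]
      \<le> 1/2 * (M [:1, \<i> * s, - complex_of_real e:] + M [:1, -\<i> * s, - complex_of_real e:])"
    by (simp only: M_smult) (use M_add[of "[:1, \<i> * s, - complex_of_real e:]" "[:1, -\<i> * s, - complex_of_real e:]"] in simp)
  then show "M [:1, 0, - complex_of_real e:] \<le> 1 + ?C * e\<^sup>2"
    using bound[of \<i>] bound[of "-\<i>"] by simp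
qed

text \<open>Boundedness of the orbit suffices because \<open>n \<mapsto> M (f x\<^sup>n)\<close> is logarithmically convex.\<close>
lemma M_le_of_power_bounded:
  assumes real: "map_poly cnj x = x" and D: "D > 0"
    and bd: "\<And>n. M (f * x ^ n) \<le> K * D ^ n"
  shows "M (f * x) \<le> D * M f"
proof -
  have real_pow: "map_poly cnj (x ^ n) = x ^ n" for n
    by (simp add: real map_poly_cnj_power)
  \<comment> \<open>Logarithmic convexity: since \<open>x\<close> is real,
    \<open>(f x\<^sup>n)* (f x\<^sup>n)\<close> equals \<open>f*\<close> times
    \<open>f x\<^sup>2\<^sup>n\<close>.\<close>
  have step: "(M (f * x ^ n))\<^sup>2 \<le> M f * M (f * x ^ (2 * n))" for n
  proof -
    have "x ^ (2 * n) = x ^ n * x ^ n" by (simp add: mult_2 power_add)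
    then have "map_poly cnj (f * x ^ n) * (f * x ^ n) = map_poly cnj f * (f * x ^ (2 * n))"
      by (simp only: real_pow map_poly_cnj_mult mult_ac)
    then show ?thesis using M_mult[of "map_poly cnj f" "f * x ^ (2 * n)"] M_star[of "f * x ^ n"]
      by (simp only: M_cnj)
  qed
  show ?thesis
  proof (cases "M f = 0")
    case True
    then show ?thesis using step[of 1] by simp
  next
    case False
    then have f0: "M f > 0" using M_nonneg[of f] by simp
    \<comment> \<open>This bounds the \<open>2 ^ k\<close>-th power of
      \<open>M (f * x) / M f\<close> by \<open>M (f * x ^ 2 ^ k) / M f\<close>, with the
      denominators cleared.\<close>
    have "M (f * x) ^ 2 ^ k * M f \<le> M f ^ 2 ^ k * M (f * x ^ 2 ^ k)" for k
    proof (induction k)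
      case (Suc k)
      have "(M (f * x) ^ 2 ^ Suc k * M f) * M f = (M (f * x) ^ 2 ^ k * M f)\<^sup>2"
        by (simp add: mult_2 power_add power2_eq_square)
      also have "\<dots> \<le> (M f ^ 2 ^ k * M (f * x ^ 2 ^ k))\<^sup>2"
        using Suc by (intro power_mono) (simp_all add: M_nonneg)
      also have "\<dots> = M f ^ 2 ^ Suc k * (M (f * x ^ 2 ^ k))\<^sup>2"
        by (simp add: mult_2 power_add power2_eq_square)
      also have "\<dots> \<le> M f ^ 2 ^ Suc k * (M f * M (f * x ^ 2 ^ Suc k))"
        using step[of "2 ^ k"] by (intro mult_left_mono) (simp_all add: M_nonneg)
      finally have "(M (f * x) ^ 2 ^ Suc k * M f) * M f
          \<le> (M f ^ 2 ^ Suc k * M (f * x ^ 2 ^ Suc k)) * M f" by (simp add: mult_ac)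
      then show ?case using f0 by simp
    qed (simp add: mult.commute)
    moreover have "M f ^ 2 ^ k * M (f * x ^ 2 ^ k) \<le> M f ^ 2 ^ k * (K * D ^ 2 ^ k)" for k
      by (intro mult_left_mono bd) (simp add: M_nonneg)
    ultimately have "M (f * x) ^ 2 ^ k * M f \<le> K * (D * M f) ^ 2 ^ k" for k
      by (fastforce simp: power_mult_distrib mult_ac intro: order_trans)
    then have "M (f * x) ^ 2 ^ k \<le> (K / M f) * (D * M f) ^ 2 ^ k" for k
      using f0 by (simp add: field_simps)
    then show ?thesis by (rule le_of_dyadic_powers_le[rotated]) (use D f0 in simp)
  qed
qed

text \<open>A discrete form of Liouville's theorem for \<open>z \<mapsto> exp (z X)\<close>. The bound \<open>exp (C \<bar>z\<bar>\<^sup>2)\<close> for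
  multiplication by \<open>1 + z X\<close> improves to \<open>exp (q C \<bar>z\<bar>\<^sup>2)\<close> with \<open>q = 3 (11/20)\<^sup>2 < 1\<close>, because
  \<open>1 + (20/11) w X\<close> is an average of cubes of \<open>1 + c w X\<close>. The nodes \<open>c = 1\<close> and \<open>c = (4 \<plusminus> 12 \<i>)/13\<close>
  lie in the unit disc, and are chosen so that the quadratic and cubic coefficients of the average
  vanish.\<close>
lemma M_X_eq_0:
  assumes C: "C \<ge> 0"
    and pos: "\<And>f e. [:0, 1:] dvd f \<Longrightarrow> e \<ge> 0 \<Longrightarrow> M (f * [:1, complex_of_real e:]) \<le> (1 + C * e\<^sup>2) * M f"
    and neg: "\<And>f e. [:0, 1:] dvd f \<Longrightarrow> e \<ge> 0 \<Longrightarrow> M (f * [:1, - complex_of_real e:]) \<le> (1 + C * e\<^sup>2) * M f"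
  shows "M [:0, 1:] = 0"
proof -
  have real: "map_poly cnj [:1, complex_of_real r:] = [:1, complex_of_real r:]" for r
    by (simp add: map_poly_cnj_pCons)
  have twice: "M (f * [:1, complex_of_real r:]\<^sup>2) \<le> (1 + C * r\<^sup>2)\<^sup>2 * M f" if f: "[:0, 1:] dvd f" for f r
  proof -
    have one: "M (f * [:1, complex_of_real r:]) \<le> (1 + C * r\<^sup>2) * M f" if "[:0, 1:] dvd f" for f
      using pos[OF that, of r] neg[OF that, of "-r"] by (cases "r \<ge> 0") auto
    have "M (f * [:1, complex_of_real r:]\<^sup>2) = M ((f * [:1, complex_of_real r:]) * [:1, complex_of_real r:])"
      by (simp only: power2_eq_square mult.assoc)
    also have "\<dots> \<le> (1 + C * r\<^sup>2) * M (f * [:1, complex_of_real r:])"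
      using f by (intro one dvd_mult2)
    also have "\<dots> \<le> (1 + C * r\<^sup>2) * ((1 + C * r\<^sup>2) * M f)"
      using C f by (intro mult_left_mono one) auto
    finally show ?thesis by (simp add: power2_eq_square mult_ac)
  qed
  have cplx: "M (f * [:1, z:]) \<le> (1 + C * (cmod z)\<^sup>2) * M f" if f: "[:0, 1:] dvd f" for f z
  proof (cases "z = 0")
    case True
    then show ?thesis using C by (simp add: one_pCons[symmetric])
  next
    case False
    define r where "r = cmod z"
    have r: "r > 0" using False by (simp add: r_def)
    \<comment> \<open>This weight turns \<open>\<bar>1 + z X\<bar>\<^sup>2 = 1 + 2 Re z X +
      r\<^sup>2 X\<^sup>2\<close> into a convex combination of \<open>(1 + r X)\<^sup>2\<close> and
      \<open>(1 - r X)\<^sup>2\<close>, so real multipliers of both signs control complex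
      ones.\<close>
    define \<alpha> where "\<alpha> = (1 + Re z / r) / 2"
    have Re: "Re z = r * (2 * \<alpha> - 1)" using r by (simp add: \<alpha>_def field_simps)
    have \<alpha>: "0 \<le> \<alpha>" "\<alpha> \<le> 1"
      using abs_Re_le_cmod[of z] r unfolding \<alpha>_def r_def[symmetric] by (auto simp: field_simps abs_le_iff)
    let ?ff = "map_poly cnj f * f"
    have zz: "cnj z * z = complex_of_real (r\<^sup>2)" "z + cnj z = complex_of_real (2 * r * (2 * \<alpha> - 1))"
      using complex_norm_square[of z] complex_add_cnj[of z] Re by (simp_all add: r_def mult.commute)
    have "map_poly cnj [:1, z:] * [:1, z:] = Polynomial.smult (complex_of_real \<alpha>) ([:1, complex_of_real r:]\<^sup>2)
        + Polynomial.smult (complex_of_real (1 - \<alpha>)) ([:1, complex_of_real (-r):]\<^sup>2)"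
      using zz by (simp add: map_poly_cnj_pCons power2_eq_square algebra_simps)
    then have "map_poly cnj (f * [:1, z:]) * (f * [:1, z:])
        = Polynomial.smult (complex_of_real \<alpha>) (?ff * [:1, complex_of_real r:]\<^sup>2)
        + Polynomial.smult (complex_of_real (1 - \<alpha>)) (?ff * [:1, complex_of_real (-r):]\<^sup>2)"
      by (simp only: map_poly_cnj_mult mult_smult_right[symmetric] distrib_left[symmetric] mult_ac)
    then have "(M (f * [:1, z:]))\<^sup>2 \<le> \<alpha> * M (?ff * [:1, complex_of_real r:]\<^sup>2)
        + (1 - \<alpha>) * M (?ff * [:1, complex_of_real (-r):]\<^sup>2)"
      using M_star[of "f * [:1, z:]"] \<alpha> 
        M_add[of "Polynomial.smult (complex_of_real \<alpha>) (?ff * [:1, complex_of_real r:]\<^sup>2)"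
          "Polynomial.smult (complex_of_real (1 - \<alpha>)) (?ff * [:1, complex_of_real (-r):]\<^sup>2)"]
      by (simp add: M_smult del: of_real_diff of_real_minus)
    also have "\<dots> \<le> \<alpha> * ((1 + C * r\<^sup>2)\<^sup>2 * M ?ff) + (1 - \<alpha>) * ((1 + C * r\<^sup>2)\<^sup>2 * M ?ff)"
      using \<alpha> twice[of ?ff r] twice[of ?ff "-r"] f by (intro add_mono mult_left_mono) auto
    also have "\<dots> = ((1 + C * r\<^sup>2) * M f)\<^sup>2"
      by (simp add: M_star power_mult_distrib left_diff_distrib)
    finally show ?thesis unfolding r_def
      by (rule power2_le_imp_le) (simp add: C M_nonneg)
  qed
  define q :: real where "q = 363/400"
  have iter: "[:0, 1:] dvd f \<Longrightarrow> M (f * [:1, z:]) \<le> exp (C * q ^ k * (cmod z)\<^sup>2) * M f" for f z k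
  proof (induction k arbitrary: f z)
    case 0
    have "1 + C * (cmod z)\<^sup>2 \<le> exp (C * (cmod z)\<^sup>2)" by (rule exp_ge_add_one_self)
    then have "(1 + C * (cmod z)\<^sup>2) * M f \<le> exp (C * (cmod z)\<^sup>2) * M f"
      by (intro mult_right_mono M_nonneg)
    then show ?case using cplx[OF 0, of z] by simp
  next
    case (Suc k)
    define w where "w = (11/20) * z"
    define B where "B = exp (C * q ^ k * (cmod w)\<^sup>2)"
    have q0: "q \<ge> 0" by (simp add: q_def)
    have single: "M (g * [:1, c * w:]) \<le> B * M g" if "[:0, 1:] dvd g" "cmod c \<le> 1" for g c
    proof -
      have "(cmod (c * w))\<^sup>2 \<le> (cmod w)\<^sup>2"
        using that(2) by (intro power_mono) (auto simp: norm_mult mult_left_le_one_le)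
      then have "exp (C * q ^ k * (cmod (c * w))\<^sup>2) \<le> B"
        unfolding B_def using C q0 by (intro exp_mono mult_left_mono) auto
      then show ?thesis using Suc.IH[OF that(1), of "c * w"] M_nonneg[of g]
        by (meson mult_right_mono order_trans)
    qed
    have B0: "B \<ge> 0" by (simp add: B_def)
    have cube: "M (f * [:1, c * w:] ^ 3) \<le> B ^ 3 * M f" if c: "cmod c \<le> 1" for c
    proof -
      let ?x = "[:1, c * w:]"
      have "M (f * ?x ^ 3) = M (f * ?x * ?x * ?x)" by (simp only: power3_eq_cube mult.assoc)
      also have "\<dots> \<le> B * M (f * ?x * ?x)" by (intro single c dvd_mult2 Suc.prems)
      also have "\<dots> \<le> B * (B * M (f * ?x))" by (intro mult_left_mono single c dvd_mult2 Suc.prems B0)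
      also have "\<dots> \<le> B * (B * (B * M f))" by (intro mult_left_mono single c dvd_mult2 Suc.prems B0)
      finally show ?thesis by (simp add: power3_eq_cube mult_ac)
    qed
    let ?a = "Complex (4/13) (12/13)"
    have norms: "cmod ?a \<le> 1" "cmod (cnj ?a) \<le> 1"
      by (simp_all add: cmod_def power2_eq_square)
    \<comment> \<open>The weights are positive with sum 1, so averaging costs no constant. The
      linear coefficient is \<open>3 (128/297 + 2 (169/594) (4/13)) = 20/11\<close>, which is why
      \<open>w\<close> is \<open>11/20\<close> of \<open>z\<close>.\<close>
    have av: "[:1, z:] = Polynomial.smult (128/297) ([:1, 1 * w:] ^ 3)
        + (Polynomial.smult (169/594) ([:1, ?a * w:] ^ 3) + Polynomial.smult (169/594) ([:1, cnj ?a * w:] ^ 3))"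
    proof -
      have z: "z = (20/11) * w" by (simp add: w_def)
      have a: "?a = (4 + 12 * \<i>) / 13" "cnj ?a = (4 - 12 * \<i>) / 13" by (simp_all add: complex_eq_iff)
      show ?thesis unfolding z a
        by (simp add: power3_eq_cube complex_eq_iff field_simps)
    qed
    have "M (f * [:1, z:]) = M (Polynomial.smult (128/297) (f * [:1, 1 * w:] ^ 3)
        + (Polynomial.smult (169/594) (f * [:1, ?a * w:] ^ 3) + Polynomial.smult (169/594) (f * [:1, cnj ?a * w:] ^ 3)))"
      by (subst av) (simp only: distrib_left mult_smult_right)
    also have "\<dots> \<le> 128/297 * M (f * [:1, 1 * w:] ^ 3)
        + (169/594 * M (f * [:1, ?a * w:] ^ 3) + 169/594 * M (f * [:1, cnj ?a * w:] ^ 3))"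
      by (rule order_trans[OF M_add], rule add_mono, simp add: M_smult)
        (rule order_trans[OF M_add], simp add: M_smult)
    also have "\<dots> \<le> 128/297 * (B ^ 3 * M f) + (169/594 * (B ^ 3 * M f) + 169/594 * (B ^ 3 * M f))"
      by (intro add_mono mult_left_mono cube norms) auto
    also have "\<dots> = B ^ 3 * M f" by simp
    \<comment> \<open>The cube triples the exponent and \<open>w\<close> contributes
      \<open>(11/20)\<^sup>2\<close>; together they give the extra factor \<open>q\<close>.\<close>
    also have "B ^ 3 = exp (C * q ^ Suc k * (cmod z)\<^sup>2)"
      by (simp add: B_def exp_of_nat_mult[symmetric] w_def norm_mult power2_eq_square q_def)
    finally show ?case .
  qed
  \<comment> \<open>As \<open>k\<close> grows, the exponent tends to 0 and the multiplier becomes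
    contractive on \<open>X\<close> for every complex \<open>z\<close>.\<close>
  have contr: "M ([:0, 1:] * [:1, z:]) \<le> M [:0, 1:]" for z
  proof -
    have "(\<lambda>k. q ^ k) \<longlonglongrightarrow> 0" by (intro LIMSEQ_power_zero) (simp add: q_def)
    then have "(\<lambda>k. exp (C * q ^ k * (cmod z)\<^sup>2) * M [:0, 1:]) \<longlonglongrightarrow> exp (C * 0 * (cmod z)\<^sup>2) * M [:0, 1:]"
      by (intro tendsto_mult tendsto_exp tendsto_const)
    then show ?thesis using iter[of "[:0,1:]" z]
      by (intro LIMSEQ_le_const[where a = "M ([:0, 1:] * [:1, z:])"]) auto
  qed
  have "M [:0, 0, 1:] = 0"
  proof -
    \<comment> \<open>The identity \<open>n X\<^sup>2 = X (1 + n X) - X\<close> bounds every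
      multiple of \<open>X\<^sup>2\<close> by \<open>2 M X\<close>. Hence \<open>M\<close> vanishes
      on \<open>X\<^sup>2\<close>, and then on \<open>X\<close> by the C*-identity.\<close>
    have le: "real n * M [:0, 0, 1:] \<le> 2 * M [:0, 1:]" for n
    proof -
      have "Polynomial.smult (of_nat n) [:0, 0, 1:] = [:0, 1:] * [:1, of_nat n:] - ([:0, 1:] :: complex Polynomial.poly)"
        by simp
      then have "M (Polynomial.smult (of_nat n) [:0, 0, 1:]) \<le> M ([:0, 1:] * [:1, of_nat n:]) + M [:0, 1:]"
        using M_minus by metis
      then show ?thesis using contr[of "of_nat n"] unfolding M_smult by simp
    qed
    show ?thesis
    proof (rule ccontr)
      assume "M [:0, 0, 1:] \<noteq> 0"
      then have "M [:0, 0, 1:] > 0" using M_nonneg[of "[:0, 0, 1:]"] by simp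
      then obtain n where "2 * M [:0, 1:] < real n * M [:0, 0, 1:]"
        using reals_Archimedean3 by blast
      then show False using le[of n] by simp
    qed
  qed
  moreover have "map_poly cnj [:0, 1:] * [:0, 1:] = ([:0, 0, 1:] :: complex Polynomial.poly)"
    by (simp add: map_poly_pCons)
  ultimately show ?thesis using M_star[of "[:0, 1:]"] by simp
qed

end

section \<open>Positivity in C*-algebras\<close>

context cstar_algebra
begin

section \<open>Arithmetic of scalars, adjoint and norm\<close>

lemma ring_A: "ring A" ..

lemma semiring_A: "semiring A" ..

lemma abelian_monoid_A: "abelian_monoid A" ..

text \<open>The unqualified names would otherwise refer to the scalar ring.\<close>
lemmas
      a_closed = ring.ring_simprules(1)[OF ring_A]
  and minus_closed = ring.ring_simprules(4)[OF ring_A]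
  and m_closed = ring.ring_simprules(5)[OF ring_A]
  and one_closed = ring.ring_simprules(6)[OF ring_A]
  and a_assoc = ring.ring_simprules(7)[OF ring_A]
  and a_comm = ring.ring_simprules(10)[OF ring_A]
  and m_assoc = ring.ring_simprules(11)[OF ring_A]
  and l_distr = ring.ring_simprules(13)[OF ring_A]
  and a_minus_def = ring.ring_simprules(14)[OF ring_A]
  and r_neg = ring.ring_simprules(16)[OF ring_A]
  and r_neg2 = ring.ring_simprules(17)[OF ring_A]
  and minus_add = ring.ring_simprules(19)[OF ring_A]
  and r_neg1 = ring.ring_simprules(18)[OF ring_A]
  and minus_minus = ring.ring_simprules(20)[OF ring_A]
  and minus_zero = ring.ring_simprules(21)[OF ring_A]
  and a_lcomm = ring.ring_simprules(22)[OF ring_A]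
  and r_distr = ring.ring_simprules(23)[OF ring_A]
  and l_minus = ring.ring_simprules(26)[OF ring_A]
  and r_minus = ring.ring_simprules(27)[OF ring_A]
  and minus_equality = abelian_group.minus_equality[OF ring.axioms(1)[OF ring_A]]
  and finsum_insert = abelian_monoid.finsum_insert[OF abelian_monoid_A]
  and finsum_closed = abelian_monoid.finsum_closed[OF abelian_monoid_A]
  and finsum_cong' = abelian_monoid.finsum_cong'[OF abelian_monoid_A]
  and finsum_singleton = abelian_monoid.finsum_singleton[OF abelian_monoid_A]
  and finsum_ldistr = semiring.finsum_ldistr[OF semiring_A]
lemmas a_ac = a_assoc a_comm a_lcomm

lemma scalars [simp]: "c \<in> carrier (ring_of_type_algebra :: complex ring)"
    "c \<oplus>\<^bsub>ring_of_type_algebra\<^esub> d = c + d" "c \<otimes>\<^bsub>ring_of_type_algebra\<^esub> d = c * d"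
    "\<one>\<^bsub>ring_of_type_algebra\<^esub> = (1 :: complex)" "\<zero>\<^bsub>ring_of_type_algebra\<^esub> = (0 :: complex)"
  by (simp_all add: ring_of_type_algebra_def)

lemma sm_closed [simp, intro]: "x \<in> carrier A \<Longrightarrow> (c::complex) \<odot> x \<in> carrier A"
  by (rule smult_closed) simp_all

lemma sm_add_left: "x \<in> carrier A \<Longrightarrow> (c + d) \<odot> x = c \<odot> x \<oplus> d \<odot> x"
  using smult_l_distr[of c d x] by simp

lemma sm_add_right: "x \<in> carrier A \<Longrightarrow> y \<in> carrier A \<Longrightarrow> c \<odot> (x \<oplus> y) = c \<odot> x \<oplus> c \<odot> y"
  using smult_r_distr[of c x y] by simp

lemma sm_sm [simp]: "x \<in> carrier A \<Longrightarrow> c \<odot> (d \<odot> x) = (c * d) \<odot> x"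
  using smult_assoc1[of c d x] by simp

lemma sm_one [simp]: "x \<in> carrier A \<Longrightarrow> (1::complex) \<odot> x = x"
  using smult_one[of x] by simp

lemma sm_zero_left [simp]: "x \<in> carrier A \<Longrightarrow> (0::complex) \<odot> x = \<zero>"
  using smult_l_null[of x] by simp

lemma sm_zero_right [simp]: "(c::complex) \<odot> \<zero> = \<zero>"
  using smult_r_null[of c] by simp

lemma minus_eq_sm: "x \<in> carrier A \<Longrightarrow> \<ominus> x = (-1::complex) \<odot> x"
  by (rule minus_equality) (use sm_add_left[of x "-1" 1] in simp_all)

lemma diff_eq_sm: "x \<in> carrier A \<Longrightarrow> y \<in> carrier A \<Longrightarrow> x \<ominus> y = x \<oplus> (-1::complex) \<odot> y"
  by (simp add: a_minus_def minus_eq_sm)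

lemmas sm_mult [simp] = smult_mult_left smult_mult_right
lemmas adj_in [simp, intro] = adj_closed
lemmas sm_simps = sm_add_right minus_eq_sm diff_eq_sm l_distr r_distr m_assoc

lemma adj_one [simp]: "adj A \<one> = \<one>"
proof -
  have "adj A \<one> = adj A \<one> \<otimes> adj A (adj A \<one>)" by (simp add: adj_adj)
  also have "\<dots> = adj A (adj A \<one> \<otimes> \<one>)" by (subst adj_mult) simp_all
  finally show ?thesis by (simp add: adj_adj)
qed

lemma adj_zero [simp]: "adj A \<zero> = \<zero>"
  using adj_smult[of \<zero> 0] by simp

lemma nrm_zero [simp]: "nrm A \<zero> = 0"
  using nrm_eq_zero by simp

lemma nrm_adj: "x \<in> carrier A \<Longrightarrow> nrm A (adj A x) = nrm A x"
proof -
  have le: "nrm A x \<le> nrm A (adj A x)" if x: "x \<in> carrier A" for x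
  proof (cases "nrm A x = 0")
    case False
    then have "nrm A x > 0" using nrm_nonneg[OF x] by simp
    moreover have "nrm A x * nrm A x \<le> nrm A (adj A x) * nrm A x"
      using nrm_mult[of "adj A x" x] x by (simp add: nrm_cstar power2_eq_square)
    ultimately show ?thesis by simp
  qed (simp add: nrm_nonneg x)
  assume "x \<in> carrier A"
  then show ?thesis using le[of x] le[of "adj A x"] by (simp add: adj_adj)
qed

lemma nrm_projection_le_1: "projection A r \<Longrightarrow> nrm A r \<le> 1"
proof -
  assume "projection A r"
  then have "nrm A r = (nrm A r)\<^sup>2" using nrm_cstar[of r] by (simp add: projection_def)
  then have "nrm A r = 0 \<or> nrm A r = 1" by (simp add: power2_eq_square)
  then show ?thesis by auto
qed

lemma projection_one: "projection A \<one>"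
  by (simp add: projection_def)

lemma nrm_uminus: "x \<in> carrier A \<Longrightarrow> nrm A (\<ominus> x) = nrm A x"
  by (simp add: minus_eq_sm nrm_smult)

lemma star_square_eq_0: "x \<in> carrier A \<Longrightarrow> adj A x \<otimes> x = \<zero> \<Longrightarrow> x = \<zero>"
  using nrm_cstar[of x] nrm_eq_zero[of x] by simp

section \<open>Evaluation of complex polynomials at one element\<close>

definition poly_ev :: "'a \<Rightarrow> complex Polynomial.poly \<Rightarrow> 'a" where
  "poly_ev x f = fold_coeffs (\<lambda>c t. c \<odot> \<one> \<oplus> x \<otimes> t) f \<zero>"

lemma poly_ev_0 [simp]: "poly_ev x 0 = \<zero>"
  by (simp add: poly_ev_def)

lemma poly_ev_pCons [simp]:
  "x \<in> carrier A \<Longrightarrow> poly_ev x (pCons a f) = a \<odot> \<one> \<oplus> x \<otimes> poly_ev x f"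
  by (cases "f = 0 \<and> a = 0") (auto simp: poly_ev_def)

lemma poly_ev_closed [simp, intro]: "x \<in> carrier A \<Longrightarrow> poly_ev x f \<in> carrier A"
  by (induction f) simp_all

lemma poly_ev_1 [simp]: "x \<in> carrier A \<Longrightarrow> poly_ev x 1 = \<one>"
  by (simp add: one_pCons)

lemma poly_ev_add: "x \<in> carrier A \<Longrightarrow> poly_ev x (f + g) = poly_ev x f \<oplus> poly_ev x g"
proof (induction f g rule: poly_induct2)
  case (pCons a f b g)
  then show ?case by (simp add: sm_add_left r_distr a_ac)
qed simp

lemma poly_ev_smult: "x \<in> carrier A \<Longrightarrow> poly_ev x (Polynomial.smult c f) = c \<odot> poly_ev x f"
  by (induction f) (simp_all add: sm_add_right)

text \<open>The relation \<open>a y = y b\<close> passes to powers. It serves for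
  \<open>a = y y*\<close> and \<open>b = y* y\<close>, and with \<open>a = b\<close> it says that
  polynomials in \<open>a\<close> commute with whatever commutes with \<open>a\<close>.\<close>

lemma poly_ev_intertwine:
  assumes "a \<in> carrier A" "b \<in> carrier A" "y \<in> carrier A" "a \<otimes> y = y \<otimes> b"
  shows "poly_ev a f \<otimes> y = y \<otimes> poly_ev b f"
proof (induction f)
  case (pCons c f)
  have "a \<otimes> poly_ev a f \<otimes> y = a \<otimes> (y \<otimes> poly_ev b f)"
    using pCons assms by (simp add: m_assoc)
  also have "\<dots> = y \<otimes> (b \<otimes> poly_ev b f)"
    using assms by (simp add: m_assoc[symmetric])
  finally show ?case using assms by (simp add: l_distr r_distr)
qed (use assms in simp)

lemma poly_ev_mult: "x \<in> carrier A \<Longrightarrow> poly_ev x (f * g) = poly_ev x f \<otimes> poly_ev x g"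
  by (induction f) (simp_all add: poly_ev_add poly_ev_smult l_distr m_assoc)

lemma poly_ev_adj:
  assumes x: "x \<in> carrier A" "adj A x = x"
  shows "adj A (poly_ev x f) = poly_ev x (map_poly cnj f)"
proof (induction f)
  case (pCons c f)
  then show ?case using x poly_ev_intertwine[of x x x "map_poly cnj f"]
    by (simp add: adj_add adj_smult adj_mult map_poly_cnj_pCons)
qed (use x in simp)

text \<open>This transfers the estimates on polynomials to norms in \<open>A\<close>.\<close>

lemma poly_cstar_seminorm_poly_ev:
  assumes x: "x \<in> carrier A" "adj A x = x"
  shows "poly_cstar_seminorm (\<lambda>f. nrm A (poly_ev x f))"
proof
  fix f
  show "nrm A (poly_ev x (map_poly cnj f * f)) = (nrm A (poly_ev x f))\<^sup>2"
    using x nrm_cstar[of "poly_ev x f"] by (simp add: poly_ev_mult poly_ev_adj)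
qed (use x in \<open>auto simp: poly_ev_add poly_ev_smult poly_ev_mult nrm_nonneg nrm_triangle
    nrm_smult nrm_mult nrm_projection_le_1 projection_one\<close>)

text \<open>A first-order form of positivity for self-adjoint elements: unlike the elements of the form
  \<open>z\<^sup>* z\<close>, these are closed under addition for elementary reasons.\<close>
definition pos :: "'a \<Rightarrow> bool" where
  "pos a \<longleftrightarrow> a \<in> carrier A \<and>
     (\<exists>C\<ge>0. \<forall>e\<ge>0. nrm A (\<one> \<oplus> complex_of_real (- e) \<odot> a) \<le> 1 + C * e\<^sup>2)"

lemma pos_closed: "pos a \<Longrightarrow> a \<in> carrier A"
  by (simp add: pos_def)

section \<open>Permanence properties of \<open>pos\<close>\<close>

lemma pos_scale:
  assumes a: "pos a" and t: "t \<ge> 0"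
  shows "pos (complex_of_real t \<odot> a)"
proof -
  obtain C where C: "C \<ge> 0" "\<And>e. e \<ge> 0 \<Longrightarrow> nrm A (\<one> \<oplus> complex_of_real (- e) \<odot> a) \<le> 1 + C * e\<^sup>2"
    using a by (auto simp: pos_def)
  have "nrm A (\<one> \<oplus> complex_of_real (- e) \<odot> (complex_of_real t \<odot> a)) \<le> 1 + (C * t\<^sup>2) * e\<^sup>2" if "e \<ge> 0" for e
    using C(2)[of "e * t"] that t pos_closed[OF a] by (simp add: power_mult_distrib mult_ac)
  moreover have "C * t\<^sup>2 \<ge> 0" using C by simp
  ultimately show ?thesis using pos_closed[OF a] unfolding pos_def by blast
qed

text \<open>The element \<open>1 - e (a + b)\<close> is the average of \<open>1 - 2 e a\<close> and
  \<open>1 - 2 e b\<close>; the errors remain quadratic in \<open>e\<close>.\<close>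

lemma pos_add:
  assumes a: "pos a" and b: "pos b"
  shows "pos (a \<oplus> b)"
proof -
  note carr = pos_closed[OF a] pos_closed[OF b]
  obtain C where C: "C \<ge> 0" "\<And>e. e \<ge> 0 \<Longrightarrow> nrm A (\<one> \<oplus> complex_of_real (- e) \<odot> a) \<le> 1 + C * e\<^sup>2"
    using a by (auto simp: pos_def)
  obtain D where D: "D \<ge> 0" "\<And>e. e \<ge> 0 \<Longrightarrow> nrm A (\<one> \<oplus> complex_of_real (- e) \<odot> b) \<le> 1 + D * e\<^sup>2"
    using b by (auto simp: pos_def)
  have "nrm A (\<one> \<oplus> complex_of_real (- e) \<odot> (a \<oplus> b)) \<le> 1 + (2 * C + 2 * D) * e\<^sup>2" if e: "e \<ge> 0" for e
  proof -
    let ?a = "\<one> \<oplus> complex_of_real (- (2 * e)) \<odot> a" and ?b = "\<one> \<oplus> complex_of_real (- (2 * e)) \<odot> b"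
    have "\<one> = complex_of_real (1/2) \<odot> \<one> \<oplus> complex_of_real (1/2) \<odot> \<one>"
      using sm_add_left[of \<one> "1/2" "1/2"] by simp
    then have "\<one> \<oplus> complex_of_real (- e) \<odot> (a \<oplus> b)
        = (complex_of_real (1/2) \<odot> \<one> \<oplus> complex_of_real (1/2) \<odot> \<one>) \<oplus> (complex_of_real (- e) \<odot> a \<oplus> complex_of_real (- e) \<odot> b)"
      using carr by (simp add: sm_add_right)
    also have "\<dots> = complex_of_real (1/2) \<odot> ?a \<oplus> complex_of_real (1/2) \<odot> ?b"
      using carr by (simp add: sm_add_right a_ac)
    finally have "nrm A (\<one> \<oplus> complex_of_real (- e) \<odot> (a \<oplus> b)) \<le> 1/2 * nrm A ?a + 1/2 * nrm A ?b"
      using carr nrm_triangle[of "complex_of_real (1/2) \<odot> ?a" "complex_of_real (1/2) \<odot> ?b"]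
      by (simp add: nrm_smult)
    then show ?thesis using C(2)[of "2 * e"] D(2)[of "2 * e"] e by (simp add: algebra_simps)
  qed
  moreover have "2 * C + 2 * D \<ge> 0" using C D by simp
  ultimately show ?thesis using carr unfolding pos_def by blast
qed

lemma pos_square:
  assumes x: "x \<in> carrier A" "adj A x = x"
  shows "pos (x \<otimes> x)"
proof -
  interpret poly_cstar_seminorm "\<lambda>f. nrm A (poly_ev x f)"
    using x by (rule poly_cstar_seminorm_poly_ev)
  have "poly_ev x [:1, 0, - complex_of_real e:] = \<one> \<oplus> complex_of_real (- e) \<odot> (x \<otimes> x)" for e
    using x by simp
  then show ?thesis using M_square_nearly_contractive x by (simp add: pos_def)
qed

lemma pos_projection: "projection A q \<Longrightarrow> pos q"
  using pos_square[of q] by (simp add: projection_def)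

lemma pos_zero: "pos \<zero>"
  using pos_projection[of \<zero>] by (simp add: projection_def)

lemma pos_finsum:
  assumes "finite F" "\<And>i. i \<in> F \<Longrightarrow> pos (q i)"
  shows "pos (\<Oplus>i\<in>F. q i)"
  using assms
proof (induction F rule: finite_induct)
  case (insert i F)
  then have "(\<Oplus>j\<in>insert i F. q j) = q i \<oplus> (\<Oplus>j\<in>F. q j)"
    by (intro finsum_insert) (auto simp: pos_closed)
  then show ?case using insert by (simp add: pos_add)
qed (simp add: pos_zero)

lemma adj_minus: "x \<in> carrier A \<Longrightarrow> adj A (\<ominus> x) = \<ominus> adj A x"
  by (simp add: minus_eq_sm adj_smult)

text \<open>With \<open>x = y + y\<^sup>*\<close> and \<open>w = i (y - y\<^sup>*)\<close>, one has \<open>x\<^sup>2 + w\<^sup>2 = 2 (y y\<^sup>* + y\<^sup>* y)\<close>.\<close>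
lemma pos_star_squares:
  assumes y: "y \<in> carrier A"
  shows "pos (y \<otimes> adj A y \<oplus> adj A y \<otimes> y)"
proof -
  define z where "z = adj A y"
  have z: "z \<in> carrier A" "adj A z = y" using y by (simp_all add: z_def adj_adj)
  define x where "x = y \<oplus> z"
  define w where "w = \<i> \<odot> y \<oplus> (-\<i>) \<odot> z"
  have "adj A x = x" "adj A w = w"
    using y z by (simp_all add: x_def w_def adj_add adj_smult z_def[symmetric] a_comm)
  then have pos: "pos (x \<otimes> x)" "pos (w \<otimes> w)"
    using y z by (simp_all add: pos_square x_def w_def)
  have half: "v = complex_of_real (1/2) \<odot> v \<oplus> complex_of_real (1/2) \<odot> v" if "v \<in> carrier A" for v
    using that sm_add_left[of v "1/2" "1/2"] by simp
  have cancel: "complex_of_real (1/2) \<odot> v \<oplus> complex_of_real (-1/2) \<odot> v = \<zero>" if "v \<in> carrier A" for v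
    using that sm_add_left[of v "1/2" "-1/2"] by simp
  \<comment> \<open>The terms \<open>y y\<close> and \<open>z z\<close> occur with opposite signs in
    \<open>x x\<close> and \<open>w w\<close> and cancel, while the mixed products add up.\<close>
  have eq: "complex_of_real (1/2) \<odot> (x \<otimes> x) \<oplus> complex_of_real (1/2) \<odot> (w \<otimes> w)
     = (complex_of_real (1/2) \<odot> (y \<otimes> y) \<oplus> complex_of_real (-1/2) \<odot> (y \<otimes> y))
     \<oplus> ((complex_of_real (1/2) \<odot> (z \<otimes> z) \<oplus> complex_of_real (-1/2) \<odot> (z \<otimes> z))
     \<oplus> ((complex_of_real (1/2) \<odot> (y \<otimes> z) \<oplus> complex_of_real (1/2) \<odot> (y \<otimes> z))
     \<oplus> (complex_of_real (1/2) \<odot> (z \<otimes> y) \<oplus> complex_of_real (1/2) \<odot> (z \<otimes> y))))"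
    using y z by (simp add: x_def w_def sm_add_right l_distr r_distr a_ac)
  have "complex_of_real (1/2) \<odot> (x \<otimes> x) \<oplus> complex_of_real (1/2) \<odot> (w \<otimes> w) = y \<otimes> z \<oplus> z \<otimes> y"
    using y z by (simp only: eq cancel half[symmetric] m_closed) simp
  then show ?thesis
    using pos_add[OF pos_scale[OF pos(1)] pos_scale[OF pos(2)], of "1/2" "1/2"] by (simp add: z_def)
qed

text \<open>For \<open>b = y* y\<close>, positivity of \<open>S\<close> controls
  \<open>1 + e b\<close> since \<open>b = - r S r\<close>. Hence \<open>- b\<close> is positive, and
  so is \<open>y y*\<close> as the sum of \<open>y y* + y* y\<close> and \<open>- b\<close>. This in
  turn controls \<open>1 - e b\<close> on multiples of \<open>b\<close>, and control of both signs
  forces \<open>b = 0\<close>.\<close>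

lemma compression_eq_0:
  assumes S: "pos S" and r: "projection A r" and y: "y \<in> carrier A"
    and yy: "adj A y \<otimes> y = \<ominus> (r \<otimes> S \<otimes> r)"
  shows "r \<otimes> S \<otimes> r = \<zero>"
proof -
  note Sc = pos_closed[OF S]
  have rc: "r \<in> carrier A" and rr: "r \<otimes> r = r" using r by (auto simp: projection_def)
  define b where "b = adj A y \<otimes> y"
  have b: "b \<in> carrier A" "adj A b = b" using y by (simp_all add: b_def adj_mult adj_adj)
  have br: "b \<otimes> r = b" "r \<otimes> b = b"
    using Sc rc rr by (simp_all add: b_def yy l_minus r_minus m_assoc) (simp_all add: m_assoc[symmetric] rr)
  interpret poly_cstar_seminorm "\<lambda>f. nrm A (poly_ev b f)"
    using b by (rule poly_cstar_seminorm_poly_ev)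
  obtain C where C: "C \<ge> 0" "\<And>e. e \<ge> 0 \<Longrightarrow> nrm A (\<one> \<oplus> complex_of_real (- e) \<odot> S) \<le> 1 + C * e\<^sup>2"
    using S by (auto simp: pos_def)
  \<comment> \<open>For \<open>g = g r\<close> one has \<open>g (1 + e b) = g (1 - e S) r\<close>,
    and the right-hand factor \<open>r\<close> has norm at most 1.\<close>
  have corner: "nrm A (g \<otimes> poly_ev b [:1, complex_of_real e:]) \<le> (1 + C * e\<^sup>2) * nrm A g"
    if g: "g \<in> carrier A" "g \<otimes> r = g" and e: "e \<ge> 0" for g e
  proof -
    have "b = (-1) \<odot> (r \<otimes> S \<otimes> r)" using Sc rc by (simp add: b_def yy minus_eq_sm)
    then have "g \<otimes> poly_ev b [:1, complex_of_real e:]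
        = g \<oplus> complex_of_real (- e) \<odot> (g \<otimes> r \<otimes> S \<otimes> r)"
      using g(1) Sc rc b(1) by (simp add: r_distr m_assoc)
    also have "\<dots> = g \<otimes> (\<one> \<oplus> complex_of_real (- e) \<odot> S) \<otimes> r"
      using g Sc rc by (simp add: r_distr l_distr m_assoc)
    finally have "nrm A (g \<otimes> poly_ev b [:1, complex_of_real e:])
        \<le> nrm A g * nrm A (\<one> \<oplus> complex_of_real (- e) \<odot> S) * nrm A r"
      using g Sc rc nrm_mult[of "g \<otimes> (\<one> \<oplus> complex_of_real (- e) \<odot> S)" r]
        nrm_mult[of g "\<one> \<oplus> complex_of_real (- e) \<odot> S"] nrm_nonneg[of r]
      by (smt (verit) m_closed a_closed one_closed sm_closed mult_right_mono)
    also have "\<dots> \<le> nrm A g * nrm A (\<one> \<oplus> complex_of_real (- e) \<odot> S) * 1"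
      using g Sc nrm_projection_le_1[OF r] by (intro mult_left_mono) (auto simp: nrm_nonneg)
    also have "\<dots> \<le> nrm A g * (1 + C * e\<^sup>2)"
      using g C(2)[OF e] by (simp add: mult_left_mono nrm_nonneg)
    finally show ?thesis by (simp add: mult.commute)
  qed
  \<comment> \<open>The corner estimate governs only the part under \<open>r\<close>; on the
    complement \<open>1 - r\<close> the factor \<open>1 + e b\<close> acts as the identity. The
    powers of \<open>1 + e b\<close> therefore grow like \<open>3 D\<^sup>n\<close>, with
    \<open>3 = 1 + 2\<close> from the two parts, and dyadic roots remove the 3.\<close>
  have pos_b: "nrm A (poly_ev b [:1, complex_of_real e:]) \<le> 1 + C * e\<^sup>2" if e: "e \<ge> 0" for e
  proof -
    let ?x = "[:1, complex_of_real e:]" and ?D = "1 + C * e\<^sup>2"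
    have D: "?D \<ge> 1" using C(1) by simp
    have comm: "poly_ev b f \<otimes> r = r \<otimes> poly_ev b f" for f
      using poly_ev_intertwine[of b b r f] b rc br by simp
    have cut: "nrm A (r \<otimes> poly_ev b (?x ^ n)) \<le> ?D ^ n" for n
    proof (induction n)
      case 0
      then show ?case using b rc nrm_projection_le_1[OF r] by simp
    next
      case (Suc n)
      have "r \<otimes> poly_ev b (?x ^ Suc n) = r \<otimes> poly_ev b (?x ^ n) \<otimes> poly_ev b ?x"
        using b rc by (simp only: power_Suc2 poly_ev_mult m_assoc poly_ev_closed)
      moreover have "r \<otimes> poly_ev b (?x ^ n) \<otimes> r = r \<otimes> poly_ev b (?x ^ n)"
        using b(1) rc rr by (simp add: m_assoc comm) (simp add: m_assoc[symmetric])
      ultimately have "nrm A (r \<otimes> poly_ev b (?x ^ Suc n)) \<le> ?D * nrm A (r \<otimes> poly_ev b (?x ^ n))"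
        using corner[of "r \<otimes> poly_ev b (?x ^ n)" e] b(1) rc e by simp
      also have "\<dots> \<le> ?D * ?D ^ n" using Suc D by (intro mult_left_mono) auto
      finally show ?case by simp
    qed
    have rest: "(\<one> \<ominus> r) \<otimes> poly_ev b (?x ^ n) = \<one> \<ominus> r" for n
    proof (induction n)
      case (Suc n)
      have "(\<one> \<ominus> r) \<otimes> b = \<zero>" using b(1) rc br by (simp add: sm_simps) (metis minus_eq_sm r_neg)
      then have "(\<one> \<ominus> r) \<otimes> poly_ev b ?x = \<one> \<ominus> r"
        using b(1) rc by (simp add: r_distr)
      then show ?case using Suc b(1) rc
        by (simp only: power_Suc poly_ev_mult m_assoc[symmetric] poly_ev_closed minus_closed one_closed)
    qed (use b rc in simp)
    have bd: "nrm A (poly_ev b (?x ^ n)) \<le> 3 * ?D ^ n" for n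
    proof -
      let ?t = "poly_ev b (?x ^ n)"
      have "r \<oplus> (\<one> \<ominus> r) = \<one>"
        unfolding a_minus_def using rc by (subst a_lcomm) (simp_all add: r_neg)
      then have "?t = r \<otimes> ?t \<oplus> (\<one> \<ominus> r) \<otimes> ?t"
        using b(1) rc by (simp add: l_distr[symmetric])
      then have "nrm A ?t \<le> nrm A (r \<otimes> ?t) + nrm A (\<one> \<ominus> r)"
        using nrm_triangle[of "r \<otimes> ?t" "(\<one> \<ominus> r) \<otimes> ?t"] b(1) rc by (simp add: rest)
      moreover have "nrm A (\<one> \<ominus> r) \<le> 2"
        using nrm_triangle[of \<one> "\<ominus> r"] nrm_projection_le_1[OF r] nrm_projection_le_1[OF projection_one] rc
        by (simp add: a_minus_def nrm_uminus)
      moreover have "1 \<le> ?D ^ n" using D by (rule one_le_power)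
      ultimately show ?thesis using cut[of n] by linarith
    qed
    have "nrm A (poly_ev b ?x) ^ 2 ^ k \<le> 3 * ?D ^ 2 ^ k" for k
      using M_real_power[of ?x k] bd[of "2 ^ k"] by (simp add: map_poly_cnj_pCons)
    then show ?thesis using D by (intro le_of_dyadic_powers_le[of ?D]) auto
  qed
  have "pos (\<ominus> b)"
    unfolding pos_def using C(1) pos_b b(1) by (auto simp: minus_eq_sm)
  moreover define k where "k = y \<otimes> adj A y"
  \<comment> \<open>Kaplansky's trick: \<open>k + b\<close> is positive whatever the sign of
    \<open>b\<close>.\<close>
  have "k = (k \<oplus> b) \<oplus> \<ominus> b" using y b(1) by (simp add: k_def a_assoc r_neg)
  ultimately have "pos k" using pos_add pos_star_squares[OF y] unfolding k_def b_def by metis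
  then obtain C' where C': "C' \<ge> 0" "\<And>e. e \<ge> 0 \<Longrightarrow> nrm A (\<one> \<oplus> complex_of_real (- e) \<odot> k) \<le> 1 + C' * e\<^sup>2"
    by (auto simp: pos_def)
  have kc: "k \<in> carrier A" using y by (simp add: k_def)
  have ky: "poly_ev k f \<otimes> y = y \<otimes> poly_ev b f" for f
    using y by (intro poly_ev_intertwine) (simp_all add: k_def b_def m_assoc)
  have "nrm A (poly_ev b [:0, 1:]) = 0"
  proof (rule M_X_eq_0[of "max C C'"])
    show "0 \<le> max C C'" using C(1) by simp
    fix f :: "complex Polynomial.poly" and e :: real
    assume f: "[:0, 1:] dvd f" and e: "0 \<le> e"
    then obtain f' where f': "f = [:0, 1:] * f'" by (elim dvdE)
    \<comment> \<open>A polynomial divisible by \<open>X\<close> takes a value with a factor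
      \<open>b\<close> on either side, so it is fixed by \<open>r\<close> and can be rewritten
      through \<open>y\<close>.\<close>
    have fb: "poly_ev b f = b \<otimes> poly_ev b f'" "poly_ev b f = poly_ev b f' \<otimes> b"
      using b(1) poly_ev_intertwine[of b b b f'] by (simp_all add: f' poly_ev_add)
    show "nrm A (poly_ev b (f * [:1, complex_of_real e:])) \<le> (1 + max C C' * e\<^sup>2) * nrm A (poly_ev b f)"
    proof -
      have "poly_ev b f \<otimes> r = poly_ev b f" using b(1) rc br by (simp add: fb(2) m_assoc)
      then have "nrm A (poly_ev b (f * [:1, complex_of_real e:])) \<le> (1 + C * e\<^sup>2) * nrm A (poly_ev b f)"
        using corner[of "poly_ev b f" e] e b(1) by (simp only: poly_ev_mult poly_ev_closed)
      also have "\<dots> \<le> (1 + max C C' * e\<^sup>2) * nrm A (poly_ev b f)"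
        by (intro mult_right_mono add_left_mono) (auto simp: M_nonneg)
      finally show ?thesis .
    qed
    let ?x = "[:1, - complex_of_real e:]"
    show "nrm A (poly_ev b (f * ?x)) \<le> (1 + max C C' * e\<^sup>2) * nrm A (poly_ev b f)"
    \<comment> \<open>Passing from \<open>b\<close> to \<open>k\<close> costs a factor depending on
      \<open>f\<close> and \<open>y\<close>. It is the same for all powers, so it plays the part of
      \<open>K\<close> and drops out.\<close>
    proof (rule M_le_of_power_bounded)
      show "map_poly cnj ?x = ?x" by (simp add: map_poly_cnj_pCons)
      show D: "0 < 1 + max C C' * e\<^sup>2" using C(1) by (simp add: add_pos_nonneg)
      fix n
      have kx: "nrm A (poly_ev k ?x) \<le> 1 + max C C' * e\<^sup>2"
      proof -
        have "poly_ev k ?x = \<one> \<oplus> complex_of_real (- e) \<odot> k" using kc by simp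
        moreover have "1 + C' * e\<^sup>2 \<le> 1 + max C C' * e\<^sup>2" by (intro add_left_mono mult_right_mono) auto
        ultimately show ?thesis using C'(2)[OF e] by simp
      qed
      have kxn: "nrm A (poly_ev k (?x ^ n)) \<le> (1 + max C C' * e\<^sup>2) ^ n"
      proof (induction n)
        case 0
        then show ?case using kc nrm_projection_le_1[OF projection_one] by simp
      next
        case (Suc n)
        have "nrm A (poly_ev k (?x ^ Suc n)) \<le> nrm A (poly_ev k ?x) * nrm A (poly_ev k (?x ^ n))"
          using kc by (simp only: power_Suc poly_ev_mult) (intro nrm_mult poly_ev_closed)
        also have "\<dots> \<le> (1 + max C C' * e\<^sup>2) * (1 + max C C' * e\<^sup>2) ^ n"
          using Suc kx kc D by (intro mult_mono) (auto simp: nrm_nonneg)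
        finally show ?case by simp
      qed
      \<comment> \<open>Writing \<open>b = y* y\<close> and moving the right-hand \<open>y\<close>
        across \<open>(1 - e b)\<^sup>n\<close> turns that power into
        \<open>(1 - e k)\<^sup>n\<close>.\<close>
      have "poly_ev b (f * ?x ^ n) = poly_ev b f' \<otimes> adj A y \<otimes> (poly_ev k (?x ^ n) \<otimes> y)"
        using b(1) y unfolding ky poly_ev_mult[OF b(1)] fb(2) by (simp add: b_def m_assoc)
      then have "nrm A (poly_ev b (f * ?x ^ n))
          \<le> (nrm A (poly_ev b f') * nrm A (adj A y)) * (nrm A (poly_ev k (?x ^ n)) * nrm A y)"
        using y b(1) kc
        by (auto intro!: order_trans[OF nrm_mult] mult_mono mult_nonneg_nonneg simp: nrm_nonneg nrm_mult)
      also have "\<dots> \<le> (nrm A (poly_ev b f') * nrm A (adj A y)) * ((1 + max C C' * e\<^sup>2) ^ n * nrm A y)"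
        using y b(1) kxn less_imp_le[OF D] by (intro mult_mono) (auto simp: nrm_nonneg kc)
      finally show "nrm A (poly_ev b (f * ?x ^ n))
          \<le> (nrm A (poly_ev b f') * nrm A (adj A y) * nrm A y) * (1 + max C C' * e\<^sup>2) ^ n"
        by (simp add: mult_ac)
    qed
  qed
  then have "b = \<zero>" using b(1) nrm_eq_zero[of b] by simp
  then show ?thesis using yy Sc rc unfolding b_def
    by (metis minus_minus m_closed minus_zero)
qed

end

section \<open>Closed spans\<close>

context cstar_algebra
begin

section \<open>Norm topology and closures of *-subalgebras\<close>

lemma nrm_diff_commute: "x \<in> carrier A \<Longrightarrow> y \<in> carrier A \<Longrightarrow> nrm A (x \<ominus> y) = nrm A (y \<ominus> x)"
  using nrm_smult[of "x \<ominus> y" "-1"] by (simp add: sm_simps a_comm)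

lemma diff_split: 
  assumes "x \<in> carrier A" "y \<in> carrier A" "z \<in> carrier A"
  shows "x \<ominus> z = (x \<ominus> y) \<oplus> (y \<ominus> z)"
  using assms by (simp add: a_minus_def a_assoc r_neg1)

lemma metric_space_A: "Metric_space (carrier A) (cstar_dist A)"
proof
  fix x y z
  show "0 \<le> cstar_dist A x y" by (simp add: cstar_dist_def nrm_nonneg)
  show "cstar_dist A x y = cstar_dist A y x" by (simp add: cstar_dist_def nrm_diff_commute)
  assume x: "x \<in> carrier A" and y: "y \<in> carrier A"
  have "x = y" if "x \<ominus> y = \<zero>"
  proof -
    have "x = (x \<ominus> y) \<oplus> y" using x y by (simp add: a_minus_def a_assoc a_comm[of "\<ominus> y"] r_neg)
    then show ?thesis using that y by simp
  qed
  moreover have "y \<ominus> y = \<zero>" using y by (simp add: a_minus_def r_neg)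
  ultimately show "cstar_dist A x y = 0 \<longleftrightarrow> x = y"
    using x y by (auto simp: cstar_dist_def nrm_eq_zero)
  assume z: "z \<in> carrier A"
  show "cstar_dist A x z \<le> cstar_dist A x y + cstar_dist A y z"
    using x y z nrm_triangle[of "x \<ominus> y" "y \<ominus> z"] by (simp add: cstar_dist_def diff_split[of x y z])
qed

lemma closure_of_eq:
  assumes "T \<subseteq> carrier A"
  shows "cstar_topology A closure_of T = {x \<in> carrier A. \<forall>e>0. \<exists>y\<in>T. nrm A (x \<ominus> y) < e}"
proof -
  interpret Metric_space "carrier A" "cstar_dist A" by (rule metric_space_A)
  show ?thesis using assms unfolding cstar_topology_def metric_closure_of
    by (auto simp: cstar_dist_def subset_iff)
qed

text \<open>All operations are norm continuous, so approximants from \<open>T\<close> can be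
  combined by the same operation.\<close>

lemma cstar_subalgebra_closure:
  assumes T: "subring T A" and sm: "\<And>c x. x \<in> T \<Longrightarrow> c \<odot> x \<in> T" and ad: "\<And>x. x \<in> T \<Longrightarrow> adj A x \<in> T"
  shows "cstar_subalgebra (cstar_topology A closure_of T) A"
proof -
  let ?T = "cstar_topology A closure_of T"
  note sub = subringE[OF T]
  note mem = closure_of_eq[OF sub(1)]
  have inT: "x \<in> ?T" if "x \<in> T" for x
  proof -
    have xc: "x \<in> carrier A" using that sub(1) by auto
    then have "nrm A (x \<ominus> x) = 0" by (simp add: a_minus_def r_neg)
    then show ?thesis unfolding mem using that xc
      by (intro CollectI conjI allI impI bexI[of _ x]) simp_all
  qed
  have smT: "c \<odot> x \<in> ?T" if x: "x \<in> ?T" for c x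
  proof -
    have xc: "x \<in> carrier A" using x by (simp add: mem)
    have "\<exists>y\<in>T. nrm A (c \<odot> x \<ominus> y) < e" if "e > 0" for e
    proof -
      \<comment> \<open>The summand 1 keeps the divisor positive when \<open>c = 0\<close>.\<close>
      have pos: "cmod c + 1 > 0" by (simp add: add_nonneg_pos)
      then have "e / (cmod c + 1) > 0" using that by simp
      then obtain y where y: "y \<in> T" "nrm A (x \<ominus> y) < e / (cmod c + 1)"
        using x by (auto simp: mem)
      have yc: "y \<in> carrier A" using y sub(1) by auto
      have "c \<odot> x \<ominus> c \<odot> y = c \<odot> (x \<ominus> y)" using xc yc by (simp add: sm_simps mult.commute)
      then have "nrm A (c \<odot> x \<ominus> c \<odot> y) = cmod c * nrm A (x \<ominus> y)" using xc yc by (simp add: nrm_smult minus_closed)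
      also have "\<dots> \<le> (cmod c + 1) * nrm A (x \<ominus> y)"
        using xc yc by (intro mult_right_mono) (auto simp: nrm_nonneg minus_closed)
      also have "\<dots> < e" using y(2) pos_less_divide_eq[OF pos] by (simp add: mult.commute)
      finally show ?thesis using sm[OF y(1)] by blast
    qed
    then show ?thesis using xc by (simp add: mem)
  qed
  have "subring ?T A"
  proof (rule ring.subringI[OF ring_A])
    show "?T \<subseteq> carrier A" by (auto simp: mem)
    show "\<one> \<in> ?T" using inT sub(3) by blast
    show "\<ominus> x \<in> ?T" if "x \<in> ?T" for x
      using smT[OF that, of "-1"] that by (simp add: mem minus_eq_sm)
    fix x y assume x: "x \<in> ?T" and y: "y \<in> ?T"
    have xc: "x \<in> carrier A" and yc: "y \<in> carrier A" using x y by (auto simp: mem)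
    show "x \<oplus> y \<in> ?T"
    proof -
      have "\<exists>z\<in>T. nrm A (x \<oplus> y \<ominus> z) < e" if "e > 0" for e
      proof -
        have "e / 2 > 0" using that by simp
        then obtain x' y' where x': "x' \<in> T" "nrm A (x \<ominus> x') < e / 2"
          and y': "y' \<in> T" "nrm A (y \<ominus> y') < e / 2" using x y unfolding mem by blast
        have c: "x' \<in> carrier A" "y' \<in> carrier A" using x' y' sub(1) by auto
        have "x \<oplus> y \<ominus> (x' \<oplus> y') = (x \<ominus> x') \<oplus> (y \<ominus> y')"
          using xc yc c by (simp add: sm_simps a_ac)
        then have "nrm A (x \<oplus> y \<ominus> (x' \<oplus> y')) < e"
          using nrm_triangle[of "x \<ominus> x'" "y \<ominus> y'"] xc yc c x' y' by (simp add: minus_closed)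
        then show ?thesis using sub(7)[OF x'(1) y'(1)] by blast
      qed
      then show ?thesis using xc yc by (simp add: mem)
    qed
    show "x \<otimes> y \<in> ?T"
    proof -
      have "\<exists>z\<in>T. nrm A (x \<otimes> y \<ominus> z) < e" if e: "e > 0" for e
      proof -
        \<comment> \<open>\<open>K\<close> must bound \<open>x\<close> and also the approximant
          \<open>y'\<close>. The minimum with 1 below gives
          \<open>nrm A y' \<le> nrm A y + 1 \<le> K\<close>.\<close>
        define K where "K = nrm A x + nrm A y + 1"
        have K: "K > 0" "nrm A x \<le> K" "nrm A y + 1 \<le> K"
          using nrm_nonneg[OF xc] nrm_nonneg[OF yc] by (auto simp: K_def)
        have "e / (2 * K) > 0" "min 1 (e / (2 * K)) > 0" using e K by auto
        then obtain x' y' where x': "x' \<in> T" "nrm A (x \<ominus> x') < e / (2 * K)"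
          and y': "y' \<in> T" "nrm A (y \<ominus> y') < min 1 (e / (2 * K))" using x y unfolding mem by blast
        have c: "x' \<in> carrier A" "y' \<in> carrier A" using x' y' sub(1) by auto
        have "y' = y \<oplus> (y' \<ominus> y)"
          using yc c by (simp add: a_minus_def a_lcomm[of y] r_neg)
        then have "nrm A y' \<le> nrm A y + nrm A (y' \<ominus> y)"
          using nrm_triangle[of y "y' \<ominus> y"] yc c by (simp add: minus_closed)
        then have y'K: "nrm A y' \<le> K"
          using y'(2) K nrm_diff_commute[OF yc c(2)] by simp
        have "x \<otimes> y \<ominus> x' \<otimes> y' = (x \<otimes> y \<ominus> x \<otimes> y') \<oplus> (x \<otimes> y' \<ominus> x' \<otimes> y')"
          using xc yc c by (intro diff_split) simp_all
        also have "\<dots> = x \<otimes> (y \<ominus> y') \<oplus> (x \<ominus> x') \<otimes> y'"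
          using xc yc c by (simp add: a_minus_def r_distr l_distr r_minus l_minus)
        finally have "nrm A (x \<otimes> y \<ominus> x' \<otimes> y') \<le> nrm A (x \<otimes> (y \<ominus> y')) + nrm A ((x \<ominus> x') \<otimes> y')"
          using nrm_triangle[of "x \<otimes> (y \<ominus> y')" "(x \<ominus> x') \<otimes> y'"] xc yc c by (simp add: minus_closed)
        also have "\<dots> \<le> nrm A x * nrm A (y \<ominus> y') + nrm A (x \<ominus> x') * nrm A y'"
          using xc yc c by (intro add_mono nrm_mult) (simp_all add: minus_closed)
        also have "\<dots> \<le> K * nrm A (y \<ominus> y') + nrm A (x \<ominus> x') * K"
          using xc yc c K y'K by (intro add_mono mult_right_mono mult_left_mono) (simp_all add: nrm_nonneg minus_closed)
        also have "\<dots> < K * (e / (2 * K)) + (e / (2 * K)) * K"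
          using x'(2) y'(2) K by (intro add_strict_mono mult_strict_left_mono mult_strict_right_mono) auto
        also have "\<dots> = e" using K by simp
        finally show ?thesis using sub(6)[OF x'(1) y'(1)] by blast
      qed
      then show ?thesis using xc yc by (simp add: mem)
    qed
  qed
  moreover have "adj A x \<in> ?T" if x: "x \<in> ?T" for x
  proof -
    have xc: "x \<in> carrier A" using x by (simp add: mem)
    have "\<exists>y\<in>T. nrm A (adj A x \<ominus> y) < e" if e: "e > 0" for e
    proof -
      obtain y where y: "y \<in> T" "nrm A (x \<ominus> y) < e" using x e by (auto simp: mem)
      have yc: "y \<in> carrier A" using y sub(1) by auto
      have "adj A x \<ominus> adj A y = adj A (x \<ominus> y)"
        using xc yc by (simp add: a_minus_def adj_add adj_minus)
      then show ?thesis using y(2) nrm_adj[of "x \<ominus> y"] xc yc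
        by (intro bexI[OF _ ad[OF y(1)]]) (simp add: minus_closed)
    qed
    then show ?thesis using xc by (simp add: mem)
  qed
  ultimately show ?thesis using smT unfolding cstar_subalgebra_def by simp
qed

section \<open>Linear spans\<close>

context
  fixes S
  assumes S: "S \<subseteq> carrier A"
begin

lemma cspan_zero: "\<zero> \<in> cspan A S"
  unfolding cspan_def by (auto intro!: exI[of _ "{}"])

text \<open>In \<open>cspan\<close> the sum runs over a set, so each element occurs once. If
  \<open>s\<close> already occurs in \<open>x\<close>, its two coefficients have to be
  merged.\<close>

lemma cspan_insert:
  assumes s: "s \<in> S" and x: "x \<in> cspan A S"
  shows "c \<odot> s \<oplus> x \<in> cspan A S"
proof -
  obtain F d where F: "finite F" "F \<subseteq> S" and xe: "x = (\<Oplus>t\<in>F. d t \<odot> t)"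
    using x by (auto simp: cspan_def)
  define F' where "F' = F - {s}"
  \<comment> \<open>The coefficient of \<open>s\<close> in \<open>x\<close>, which is 0 if
    \<open>s\<close> does not occur.\<close>
  define d' where "d' = (if s \<in> F then d s else 0)"
  define w where "w = (\<Oplus>t\<in>F'. d t \<odot> t)"
  have F': "finite F'" "s \<notin> F'" "F' \<subseteq> S" using F by (auto simp: F'_def)
  have carr: "s \<in> carrier A" "w \<in> carrier A"
    using S s F' by (auto simp: w_def intro!: finsum_closed)
  have xs: "x = d' \<odot> s \<oplus> w"
  proof (cases "s \<in> F")
    case True
    then have "F = insert s F'" by (auto simp: F'_def)
    then have "x = (\<Oplus>t\<in>insert s F'. d t \<odot> t)" by (simp only: xe)
    also have "\<dots> = d s \<odot> s \<oplus> w" unfolding w_def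
      using F' S s by (intro finsum_insert) auto
    finally show ?thesis using True by (simp add: d'_def)
  qed (use carr in \<open>simp add: d'_def w_def F'_def xe\<close>)
  define f where "f = (d(s := c + d'))"
  have "(\<Oplus>t\<in>insert s F'. f t \<odot> t) = f s \<odot> s \<oplus> (\<Oplus>t\<in>F'. f t \<odot> t)"
    using F' S s by (intro finsum_insert) auto
  also have "(\<Oplus>t\<in>F'. f t \<odot> t) = w"
    unfolding w_def using F' S by (intro finsum_cong') (auto simp: f_def)
  finally have "c \<odot> s \<oplus> x = (\<Oplus>t\<in>insert s F'. f t \<odot> t)"
    using carr by (simp add: xs f_def sm_add_left a_assoc)
  then show ?thesis unfolding cspan_def using F' s by blast
qed

lemma cspan_induct [consumes 1, case_names zero insert]:
  assumes x: "x \<in> cspan A S" and zero: "P \<zero>"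
    and insert: "\<And>c s y. s \<in> S \<Longrightarrow> y \<in> cspan A S \<Longrightarrow> P y \<Longrightarrow> P (c \<odot> s \<oplus> y)"
  shows "P x"
proof -
  obtain F d where F: "finite F" "F \<subseteq> S" and xe: "x = (\<Oplus>t\<in>F. d t \<odot> t)"
    using x by (auto simp: cspan_def)
  from F have "(\<Oplus>t\<in>F. d t \<odot> t) \<in> cspan A S \<and> P (\<Oplus>t\<in>F. d t \<odot> t)"
  proof (induction F rule: finite_induct)
    case empty
    then show ?case by (simp add: zero cspan_zero)
  next
    case (insert s F)
    have "(\<Oplus>t\<in>insert s F. d t \<odot> t) = d s \<odot> s \<oplus> (\<Oplus>t\<in>F. d t \<odot> t)"
      using insert S by (intro finsum_insert) auto
    then show ?case using insert assms(3) cspan_insert by auto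
  qed
  then show ?thesis by (simp add: xe)
qed

lemma cspan_subset: "cspan A S \<subseteq> carrier A"
proof
  fix x assume "x \<in> cspan A S"
  then show "x \<in> carrier A" by (induction rule: cspan_induct) (use S in auto)
qed

lemma cspan_base: "s \<in> S \<Longrightarrow> s \<in> cspan A S"
  using cspan_insert[of s \<zero> 1] cspan_zero S by auto

lemma cspan_add: "x \<in> cspan A S \<Longrightarrow> y \<in> cspan A S \<Longrightarrow> x \<oplus> y \<in> cspan A S"
proof (induction rule: cspan_induct)
  case zero
  then show ?case using cspan_subset by auto
next
  case (insert c s x)
  have "c \<odot> s \<oplus> x \<oplus> y = c \<odot> s \<oplus> (x \<oplus> y)"
    using insert S cspan_subset by (intro a_assoc) auto
  then show ?case using insert cspan_insert by simp
qed

lemma cspan_smult: "x \<in> cspan A S \<Longrightarrow> c \<odot> x \<in> cspan A S"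
proof (induction rule: cspan_induct)
  case (insert d s x)
  have "s \<in> carrier A" "x \<in> carrier A" using insert S cspan_subset by auto
  then have "c \<odot> (d \<odot> s \<oplus> x) = (c * d) \<odot> s \<oplus> c \<odot> x" by (simp add: sm_add_right)
  then show ?case using insert cspan_insert by simp
qed (simp add: cspan_zero)

lemma cspan_adj:
  assumes "\<And>s. s \<in> S \<Longrightarrow> adj A s \<in> S"
  shows "x \<in> cspan A S \<Longrightarrow> adj A x \<in> cspan A S"
proof (induction rule: cspan_induct)
  case (insert d s x)
  have "s \<in> carrier A" "x \<in> carrier A" using insert S cspan_subset by auto
  then have "adj A (d \<odot> s \<oplus> x) = cnj d \<odot> adj A s \<oplus> adj A x" by (simp add: adj_add adj_smult)
  then show ?case using insert assms cspan_insert by simp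
qed (simp add: cspan_zero)

lemma cspan_left_mult:
  assumes a: "a \<in> carrier A" "\<And>s. s \<in> S \<Longrightarrow> a \<otimes> s \<in> cspan A S"
  shows "x \<in> cspan A S \<Longrightarrow> a \<otimes> x \<in> cspan A S"
proof (induction rule: cspan_induct)
  case (insert d s x)
  have "s \<in> carrier A" "x \<in> carrier A" using insert S cspan_subset by auto
  then have "a \<otimes> (d \<odot> s \<oplus> x) = d \<odot> (a \<otimes> s) \<oplus> a \<otimes> x" using a by (simp add: r_distr)
  then show ?case using insert a cspan_add cspan_smult by simp
qed (use a in \<open>simp add: cspan_zero\<close>)

text \<open>Products are bilinear: induction on the left factor reduces it to a generator, and
  \<open>cspan_left_mult\<close> does the same for the right factor.\<close>

lemma subring_cspan:
  assumes one: "\<one> \<in> cspan A S" and mult: "\<And>s t. s \<in> S \<Longrightarrow> t \<in> S \<Longrightarrow> s \<otimes> t \<in> cspan A S"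
  shows "subring (cspan A S) A"
proof (rule ring.subringI[OF ring_A cspan_subset one])
  fix x y assume x: "x \<in> cspan A S"
  show "\<ominus> x \<in> cspan A S" using x cspan_smult[of x "-1"] cspan_subset by (auto simp: minus_eq_sm)
  assume y: "y \<in> cspan A S"
  show "x \<oplus> y \<in> cspan A S" using x y by (rule cspan_add)
  have yc: "y \<in> carrier A" using y cspan_subset by auto
  from x show "x \<otimes> y \<in> cspan A S"
  proof (induction rule: cspan_induct)
    case (insert d s x)
    have c: "s \<in> carrier A" "x \<in> carrier A" using insert S cspan_subset by auto
    then have "(d \<odot> s \<oplus> x) \<otimes> y = d \<odot> (s \<otimes> y) \<oplus> x \<otimes> y" using yc by (simp add: l_distr)
    moreover have "s \<otimes> y \<in> cspan A S"
      using cspan_left_mult[OF c(1) mult y] insert by blast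
    ultimately show ?case using insert cspan_add cspan_smult by simp
  qed (use yc in \<open>simp add: cspan_zero\<close>)
qed

end

end

section \<open>Toeplitz families\<close>

locale toeplitz_representation =
  faithful_self_similar_action E G \<phi> + fin_digraph E + cstar_algebra A
  for E :: "('v, 'e) pre_digraph" and G :: "('v, 'g) groupoid"
    and \<phi> :: "'g \<Rightarrow> ('v, 'e) piso" and A :: "'a cstar_alg" (structure) +
  fixes u :: "'g \<Rightarrow> 'a" and p :: "'v \<Rightarrow> 'a" and s :: "'e \<Rightarrow> 'a"
  assumes family: "toeplitz_family E G \<phi> A u p s"
begin

section \<open>Relations among the generators\<close>

lemma u_rep: "unitary_representation G A u" and tck: "toeplitz_CK_family E A p s"
  and u_id: "v \<in> verts E \<Longrightarrow> u (gid G v) = p v" and sum_p: "(\<Oplus>v\<in>verts E. p v) = \<one>"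
  and u_s: "g \<in> arrs G \<Longrightarrow> e \<in> arcs E \<Longrightarrow> u g \<otimes> s e =
        (if gdom G g = head E e then s (act_edge E \<phi> g e) \<otimes> u (restriction E G \<phi> g e) else \<zero>)"
  using family by (simp_all add: toeplitz_family_def)

lemma p_proj: "v \<in> verts E \<Longrightarrow> projection A (p v)"
  and p_orth: "v \<in> verts E \<Longrightarrow> w \<in> verts E \<Longrightarrow> v \<noteq> w \<Longrightarrow> p v \<otimes> p w = \<zero>"
  and s_pi: "e \<in> arcs E \<Longrightarrow> partial_isometry A (s e)"
  and s_source: "e \<in> arcs E \<Longrightarrow> adj A (s e) \<otimes> s e = p (tail E e)"
  and p_ge: "v \<in> verts E \<Longrightarrow> cstar_le A (\<Oplus>e\<in>in_arcs E v. s e \<otimes> adj A (s e)) (p v)"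
  using tck by (simp_all add: toeplitz_CK_family_def)

lemma p_closed [simp, intro]: "v \<in> verts E \<Longrightarrow> p v \<in> carrier A"
  and p_adj: "v \<in> verts E \<Longrightarrow> adj A (p v) = p v"
  and p_idem: "v \<in> verts E \<Longrightarrow> p v \<otimes> p v = p v"
  using p_proj by (auto simp: projection_def)

lemma s_closed [simp, intro]: "e \<in> arcs E \<Longrightarrow> s e \<in> carrier A"
  using s_pi by (simp add: partial_isometry_def)

lemma s_p: "e \<in> arcs E \<Longrightarrow> s e \<otimes> p (tail E e) = s e"
  using s_pi[of e] s_source[of e] by (simp add: partial_isometry_def m_assoc)

lemma u_closed [simp, intro]: "g \<in> arrs G \<Longrightarrow> u g \<in> carrier A"
  using u_rep by (simp add: unitary_representation_def partial_isometry_def)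

lemma u_mult: "g \<in> arrs G \<Longrightarrow> h \<in> arrs G \<Longrightarrow>
    u g \<otimes> u h = (if gdom G g = gcod G h then u (gcomp G g h) else \<zero>)"
  using u_rep by (simp add: unitary_representation_def)

lemma dom_verts [simp]: "g \<in> arrs G \<Longrightarrow> gdom G g \<in> verts E"
  and cod_verts [simp]: "g \<in> arrs G \<Longrightarrow> gcod G g \<in> verts E"
  using dom_in cod_in unit_space by auto

lemma id_arrs [simp]: "v \<in> verts E \<Longrightarrow> gid G v \<in> arrs G"
  using id_in unit_space by auto

lemma id_dom [simp]: "v \<in> verts E \<Longrightarrow> gdom G (gid G v) = v"
  and id_cod [simp]: "v \<in> verts E \<Longrightarrow> gcod G (gid G v) = v"
  using dom_id cod_id unit_space by auto

lemma p_u: "g \<in> arrs G \<Longrightarrow> p (gcod G g) \<otimes> u g = u g"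
  using u_mult[of "gid G (gcod G g)" g] by (simp add: u_id id_left)

lemma u_p: "g \<in> arrs G \<Longrightarrow> u g \<otimes> p (gdom G g) = u g"
  using u_mult[of g "gid G (gdom G g)"] by (simp add: u_id id_right)

text \<open>For an inverse \<open>h\<close> of \<open>g\<close>, \<open>u h\<close> and the adjoint
  of \<open>u g\<close> have the same product with \<open>u g\<close>; multiplying by the adjoint of
  \<open>u g\<close> on the right identifies them. The inverse is obtained rather than named because
  the groupoid record has no inverse operation.\<close>

lemma u_adj:
  assumes g: "g \<in> arrs G"
  obtains h where "h \<in> arrs G" "gdom G h = gcod G g" "gcod G h = gdom G g" "adj A (u g) = u h"
proof -
  obtain h where h: "h \<in> arrs G" "gdom G h = gcod G g" "gcod G h = gdom G g"
    "gcomp G h g = gid G (gdom G g)"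
    using inverses[OF g] by blast
  have "partial_isometry A (u g)" using u_rep g by (simp add: unitary_representation_def)
  then have "adj A (u g) = adj A (u g \<otimes> adj A (u g) \<otimes> u g)"
    by (simp add: partial_isometry_def)
  also have "\<dots> = (adj A (u g) \<otimes> u g) \<otimes> adj A (u g)"
    using g by (simp add: adj_mult adj_adj m_assoc)
  also have "adj A (u g) \<otimes> u g = u h \<otimes> u g"
    using u_rep g h by (simp add: unitary_representation_def)
  also have "\<dots> \<otimes> adj A (u g) = u h \<otimes> (u g \<otimes> adj A (u g))"
    using g h by (simp add: m_assoc)
  also have "u g \<otimes> adj A (u g) = p (gdom G h)"
    using u_rep g h by (simp add: unitary_representation_def u_id)
  finally show ?thesis using that[of h] h u_p[OF h(1)] by simp
qed

text \<open>A unit of \<open>G\<close> other than the range of \<open>e\<close> annihilates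
  \<open>s e\<close> by the relation for \<open>u g \<otimes> s e\<close>, so only one term of
  \<open>\<one> = \<Sum> p v\<close> survives.\<close>

lemma p_s:
  assumes e: "e \<in> arcs E"
  shows "p (head E e) \<otimes> s e = s e"
proof -
  have zero: "p v \<otimes> s e = \<zero>" if "v \<in> verts E" "v \<noteq> head E e" for v
    using u_s[of "gid G v" e] e that by (simp add: u_id)
  have "s e = (\<Oplus>v\<in>verts E. p v) \<otimes> s e" using e by (simp add: sum_p)
  also have "\<dots> = (\<Oplus>v\<in>verts E. p v \<otimes> s e)"
    using e by (intro finsum_ldistr) auto
  also have "\<dots> = (\<Oplus>v\<in>verts E. if head E e = v then p v \<otimes> s e else \<zero>)"
    using e zero by (intro finsum_cong') auto
  also have "\<dots> = p (head E e) \<otimes> s e"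
    using e by (intro finsum_singleton) auto
  finally show ?thesis by simp
qed

lemma p_mult_s: "v \<in> verts E \<Longrightarrow> e \<in> arcs E \<Longrightarrow> p v \<otimes> s e = (if v = head E e then s e else \<zero>)"
  using p_s[of e] u_s[of "gid G v" e] by (cases "v = head E e") (simp, simp add: u_id)

section \<open>Orthogonality of the edge isometries\<close>

lemma range_projections_orthogonal:
  assumes e: "e \<in> in_arcs E v" and f: "f \<in> in_arcs E v" and ef: "e \<noteq> f"
  shows "(s e \<otimes> adj A (s e)) \<otimes> (s f \<otimes> adj A (s f)) = \<zero>"
proof -
  define Q where "Q i = s i \<otimes> adj A (s i)" for i
  define I where "I = in_arcs E v"
  have I: "finite I" "i \<in> I \<Longrightarrow> i \<in> arcs E" "i \<in> I \<Longrightarrow> head E i = v" for i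
    by (auto simp: I_def in_arcs_def intro: finite_subset[OF _ finite_arcs])
  have v: "v \<in> verts E" using e by (auto simp: in_arcs_def)
  have Q: "projection A (Q i)" if "i \<in> I" for i
  proof -
    have "Q i \<otimes> Q i = s i \<otimes> adj A (s i) \<otimes> s i \<otimes> adj A (s i)"
      using I that by (simp add: Q_def m_assoc)
    also have "\<dots> = Q i" using s_pi[of i] I that by (simp add: partial_isometry_def Q_def)
    finally show ?thesis using I that by (simp add: projection_def Q_def adj_mult adj_adj)
  qed
  have Qc: "Q i \<in> carrier A" if "i \<in> I" for i using Q[OF that] by (simp add: projection_def)
  let ?r = "Q f"
  have fI: "f \<in> I" "e \<in> I - {f}" using e f ef by (auto simp: I_def)
  have r: "?r \<in> carrier A" "adj A ?r = ?r" "?r \<otimes> ?r = ?r"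
    using Q[OF fI(1)] by (auto simp: projection_def)
  obtain z where z: "z \<in> carrier A" "p v \<ominus> (\<Oplus>i\<in>I. Q i) = adj A z \<otimes> z"
    using p_ge[OF v] by (auto simp: cstar_le_def I_def Q_def)
  define S where "S = (\<Oplus>i\<in>I - {f}. Q i)"
  define S' where "S' = (\<Oplus>i\<in>I - {f} - {e}. Q i)"
  have pos: "pos S" "pos S'"
    unfolding S_def S'_def using I Q by (auto intro!: pos_finsum intro: pos_projection)
  have Sc: "S \<in> carrier A" "S' \<in> carrier A" using pos by (auto simp: pos_closed)
  have "(\<Oplus>i\<in>insert f (I - {f}). Q i) = ?r \<oplus> S"
    unfolding S_def using I Qc fI by (intro finsum_insert) auto
  then have sum1: "(\<Oplus>i\<in>I. Q i) = ?r \<oplus> S" using fI by (simp add: insert_absorb)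
  have "(\<Oplus>i\<in>insert e (I - {f} - {e}). Q i) = Q e \<oplus> S'"
    unfolding S'_def using I Qc fI by (intro finsum_insert) auto
  then have sum2: "S = Q e \<oplus> S'" using fI by (simp add: insert_absorb S_def)
  have Qe: "Q e \<in> carrier A" "adj A (Q e) = Q e" "Q e \<otimes> Q e = Q e"
    using Q[of e] fI by (auto simp: projection_def)
  have pr: "p v \<otimes> ?r = ?r" using p_s[of f] I fI v by (simp add: Q_def m_assoc[symmetric])
  \<comment> \<open>First compression, with \<open>y = z r\<close>: as
    \<open>r (p v) r = r = r r r\<close>, only \<open>- r S r\<close> remains of
    \<open>r (p v - (r + S)) r\<close>.\<close>
  have "?r \<otimes> S \<otimes> ?r = \<zero>"
  proof (rule compression_eq_0[OF pos(1) Q[OF fI(1)]])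
    show "z \<otimes> ?r \<in> carrier A" using z r by simp
    have "adj A (z \<otimes> ?r) \<otimes> (z \<otimes> ?r) = ?r \<otimes> (adj A z \<otimes> z) \<otimes> ?r"
      using z r by (simp add: adj_mult m_assoc)
    also have "\<dots> = ?r \<otimes> (p v \<ominus> (?r \<oplus> S)) \<otimes> ?r" using z sum1 by simp
    also have "\<dots> = ?r \<otimes> (p v \<otimes> ?r) \<ominus> (?r \<otimes> (?r \<otimes> ?r) \<oplus> ?r \<otimes> S \<otimes> ?r)"
      using r Sc v by (simp add: a_minus_def l_distr r_distr l_minus r_minus m_assoc)
    also have "\<dots> = \<ominus> (?r \<otimes> S \<otimes> ?r)"
      unfolding pr r(3) using r Sc by (simp add: a_minus_def minus_add r_neg1 r_neg2)
    finally show "adj A (z \<otimes> ?r) \<otimes> (z \<otimes> ?r) = \<ominus> (?r \<otimes> S \<otimes> ?r)" .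
  qed
  \<comment> \<open>Second compression, with \<open>Q e\<close> split off from \<open>S\<close>: now
    \<open>y = Q e r\<close> satisfies \<open>y* y = r (Q e) r = - r S' r\<close>, so
    \<open>y\<close> vanishes.\<close>
  then have sum0: "?r \<otimes> Q e \<otimes> ?r \<oplus> ?r \<otimes> S' \<otimes> ?r = \<zero>"
    using r Sc Qe by (simp add: sum2 l_distr r_distr)
  have yy: "adj A (Q e \<otimes> ?r) \<otimes> (Q e \<otimes> ?r) = ?r \<otimes> Q e \<otimes> ?r"
  proof -
    have "adj A (Q e \<otimes> ?r) \<otimes> (Q e \<otimes> ?r) = ?r \<otimes> (Q e \<otimes> Q e) \<otimes> ?r"
      using r Qe(1) by (simp add: adj_mult Qe(2) m_assoc)
    then show ?thesis by (simp add: Qe(3))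
  qed
  also have eq: "\<dots> = \<ominus> (?r \<otimes> S' \<otimes> ?r)"
    using r Sc Qe sum0 by (intro minus_equality[symmetric]) simp_all
  finally have "?r \<otimes> S' \<otimes> ?r = \<zero>"
    by (intro compression_eq_0[OF pos(2) Q[OF fI(1)], of "Q e \<otimes> ?r"]) (use r Qe in simp_all)
  then have "adj A (Q e \<otimes> ?r) \<otimes> (Q e \<otimes> ?r) = \<zero>" using yy eq by (simp add: minus_zero)
  then have "Q e \<otimes> ?r = \<zero>" by (rule star_square_eq_0[rotated]) (use r(1) Qe(1) in simp)
  then show ?thesis by (simp add: Q_def)
qed

text \<open>For different ranges, inserting the vertex projection \<open>p (head E e)\<close> gives
  zero. For equal ranges, inserting both range projections does.\<close>

lemma s_adj_s:
  assumes e: "e \<in> arcs E" and f: "f \<in> arcs E"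
  shows "adj A (s e) \<otimes> s f = (if e = f then p (tail E e) else \<zero>)"
proof (cases "e = f")
  case True
  then show ?thesis using e by (simp add: s_source)
next
  case ef: False
  have sub: "adj A (s e) = adj A (s e) \<otimes> p (head E e)"
    using p_s[OF e] e adj_mult[of "p (head E e)" "s e"] by (simp add: p_adj)
  show ?thesis
  proof (cases "head E e = head E f")
    case False
    have "adj A (s e) \<otimes> s f = adj A (s e) \<otimes> (p (head E e) \<otimes> s f)"
      using e f by (subst sub) (simp add: m_assoc)
    then show ?thesis using False e f ef by (simp add: p_mult_s)
  next
    case True
    have absorb: "adj A (s e) = adj A (s e) \<otimes> (s e \<otimes> adj A (s e))"
      using s_pi[OF e] e adj_mult[of "s e \<otimes> adj A (s e)" "s e"]
      by (simp add: partial_isometry_def adj_mult adj_adj)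
    have "adj A (s e) \<otimes> s f = (adj A (s e) \<otimes> (s e \<otimes> adj A (s e))) \<otimes> ((s f \<otimes> adj A (s f)) \<otimes> s f)"
      using s_pi[OF f] absorb by (simp add: partial_isometry_def)
    also have "\<dots> = adj A (s e) \<otimes> ((s e \<otimes> adj A (s e)) \<otimes> (s f \<otimes> adj A (s f))) \<otimes> s f"
      using e f by (simp add: m_assoc)
    also have "\<dots> = \<zero>"
      using range_projections_orthogonal[of e "head E e" f] e f ef True by (simp add: in_arcs_def)
    finally show ?thesis using ef by simp
  qed
qed

text \<open>These facts make \<open>g \<cdot> e\<close> and its restriction composable, so that
  \<open>u g \<otimes> s e\<close> can be rewritten repeatedly along a path.\<close>

lemma edge_action:
  assumes g: "g \<in> arrs G" and e: "e \<in> arcs E" "head E e = gdom G g"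
  shows "act_edge E \<phi> g e \<in> arcs E" "head E (act_edge E \<phi> g e) = gcod G g"
    "restriction E G \<phi> g e \<in> arrs G" "gdom G (restriction E G \<phi> g e) = tail E e"
    "gcod G (restriction E G \<phi> g e) = tail E (act_edge E \<phi> g e)"
proof -
  define v w where "v = gdom G g" and "w = gcod G g"
  have P: "is_piso E (\<phi> g)" "pdom (\<phi> g) = v" "pcod (\<phi> g) = w"
    using hom g by (auto simp: unit_preserving_hom_def PIso_def v_def w_def)
  \<comment> \<open>As \<open>vE\<^sup>0\<close> consists of \<open>v\<close> alone,
    \<open>g\<close> sends the vertex \<open>v\<close> to \<open>w\<close>; the prefix property then
    makes the image of \<open>e\<close> a single edge with range \<open>w\<close>.\<close>
  have len0: "paths_at_len E x 0 = {vpath x}" if "x \<in> verts E" for x :: 'v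
    using that by (auto simp: paths_at_len_def paths_at_def paths_def plength_def prange_def vpath_def)
  have vw: "v \<in> verts E" "w \<in> verts E" using g by (auto simp: v_def w_def)
  have "bij_betw (pmap (\<phi> g)) (paths_at_len E v 0) (paths_at_len E w 0)"
    using P unfolding is_piso_def by blast
  then have v0: "pmap (\<phi> g) (vpath v) = vpath w"
    using vw by (auto simp: len0 bij_betw_def)
  have "vpath v \<in> paths_at E v" using len0[OF vw(1)] by (auto simp: paths_at_len_def)
  moreover have "e \<in> in_arcs E (psource E (vpath v))"
    using e by (simp add: in_arcs_def psource_def vpath_def v_def)
  ultimately obtain f where f: "f \<in> in_arcs E (psource E (vpath w))"
    "pmap (\<phi> g) (pcat (vpath v) (epath E e)) = pcat (vpath w) (epath E f)"
    using P v0 unfolding is_piso_def by metis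
  have pc: "pcat (vpath v) (epath E e) = epath E e"
    using e by (simp add: pcat_def vpath_def epath_def v_def)
  have act: "act \<phi> g (epath E e) = (w, [f])"
    using f(2) unfolding pc by (simp add: act_def pcat_def vpath_def epath_def)
  then have fe: "act_edge E \<phi> g e = f" by (simp add: act_edge_def)
  have "f \<in> arcs E" "head E f = w"
    using f(1) by (auto simp: in_arcs_def psource_def vpath_def)
  then show "act_edge E \<phi> g e \<in> arcs E" "head E (act_edge E \<phi> g e) = gcod G g"
    by (simp_all add: fe w_def)
  obtain h where h: "is_restriction E G \<phi> g e h"
    using self_similar[OF g] e by (auto simp: in_arcs_def)
  then have "restriction E G \<phi> g e = h"
    unfolding restriction_def using restriction_unique by blast
  then show "restriction E G \<phi> g e \<in> arrs G" "gdom G (restriction E G \<phi> g e) = tail E e"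
    "gcod G (restriction E G \<phi> g e) = tail E (act_edge E \<phi> g e)"
    using h unfolding is_restriction_def fe act by (simp_all add: psource_def)
qed

section \<open>Products of edge isometries along paths\<close>

abbreviation sp :: "('v, 'e) path \<Rightarrow> 'a" where
  "sp \<equiv> s_path A p s"

lemma path_Nil: "(v, []) \<in> paths E \<longleftrightarrow> v \<in> verts E"
  by (simp add: paths_def)

lemma path_Cons:
  "(v, e # es) \<in> paths E \<longleftrightarrow> e \<in> arcs E \<and> head E e = v \<and> (tail E e, es) \<in> paths E"
  by (cases es) (auto simp: paths_def)

lemma psource_Cons: "psource E (v, e # es) = psource E (tail E e, es)"
  by (simp add: psource_def)

lemma sp_Nil [simp]: "sp (v, []) = p v"
  by (simp add: s_path_def)

text \<open>This includes the last edge of a path: the remaining vertex contributes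
  \<open>p (tail E e)\<close>, which \<open>s e\<close> absorbs.\<close>

lemma sp_Cons: "e \<in> arcs E \<Longrightarrow> sp (v, e # es) = s e \<otimes> sp (tail E e, es)"
  by (cases es) (simp_all add: s_path_def s_p)

lemma sp_closed [simp, intro]: "\<mu> \<in> paths E \<Longrightarrow> sp \<mu> \<in> carrier A"
proof (induction "snd \<mu>" arbitrary: \<mu>)
  case Nil
  then show ?case by (cases \<mu>) (simp add: path_Nil)
next
  case (Cons e es)
  then obtain v where \<mu>: "\<mu> = (v, e # es)" by (cases \<mu>) auto
  then show ?case using Cons.hyps(1)[of "(tail E e, es)"] Cons.prems by (simp add: path_Cons sp_Cons)
qed

lemma p_sp: "(v, es) \<in> paths E \<Longrightarrow> p v \<otimes> sp (v, es) = sp (v, es)"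
proof (cases es)
  case (Cons e es')
  assume "(v, es) \<in> paths E"
  then show ?thesis using Cons p_s[of e]
    by (auto simp: path_Cons sp_Cons m_assoc[symmetric])
qed (simp add: path_Nil p_idem)

lemma p_mult_sp:
  assumes "w \<in> verts E" "(v, es) \<in> paths E"
  shows "p w \<otimes> sp (v, es) = (if w = v then sp (v, es) else \<zero>)"
proof -
  have v: "v \<in> verts E" using assms by (simp add: paths_def)
  have "p w \<otimes> sp (v, es) = (p w \<otimes> p v) \<otimes> sp (v, es)"
    using assms v by (simp add: m_assoc p_sp)
  then show ?thesis using assms v p_sp by (auto simp: p_orth p_idem)
qed

text \<open>Lists grow at the range end, but moving an adjoint edge past \<open>u g\<close>
  lengthens the second path at its source end.\<close>

lemma path_snoc:
  assumes "(v, es) \<in> paths E" "e \<in> arcs E" "head E e = psource E (v, es)"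
  shows "(v, es @ [e]) \<in> paths E \<and> sp (v, es @ [e]) = sp (v, es) \<otimes> s e \<and> psource E (v, es @ [e]) = tail E e"
  using assms
proof (induction es arbitrary: v)
  case Nil
  then show ?case using p_s[of e]
    by (auto simp: path_Cons path_Nil sp_Cons s_p psource_def)
next
  case (Cons f es)
  then have f: "f \<in> arcs E" "head E f = v" "(tail E f, es) \<in> paths E"
    and src: "head E e = psource E (tail E f, es)"
    by (simp_all add: path_Cons psource_Cons)
  then show ?case using Cons.IH[of "tail E f"] Cons.prems(2)
    by (simp add: path_Cons psource_Cons sp_Cons m_assoc)
qed

section \<open>The spanning set and its products with generators\<close>

definition spanning :: "'a set" where
  "spanning = {sp \<mu> \<otimes> u g \<otimes> adj A (sp \<nu>) | \<mu> g \<nu>.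
     \<mu> \<in> paths E \<and> \<nu> \<in> paths E \<and> g \<in> arrs G \<and> gdom G g = psource E \<nu> \<and> gcod G g = psource E \<mu>}"

lemma spanningI:
  assumes "\<mu> \<in> paths E" "\<nu> \<in> paths E" "g \<in> arrs G" "gdom G g = psource E \<nu>" "gcod G g = psource E \<mu>"
    and "x = sp \<mu> \<otimes> u g \<otimes> adj A (sp \<nu>)"
  shows "x \<in> spanning"
  using assms unfolding spanning_def by blast

lemma spanning_closed: "spanning \<subseteq> carrier A"
  by (auto simp: spanning_def)

text \<open>Prepending \<open>e\<close> lengthens the first path if it is composable; otherwise
  \<open>p (tail E e)\<close>, inserted after \<open>s e\<close>, annihilates the product.\<close>

lemma s_spanning:
  assumes e: "e \<in> arcs E" and x: "x \<in> spanning"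
  shows "s e \<otimes> x \<in> insert \<zero> spanning"
proof -
  obtain v es g \<nu> where m: "(v, es) \<in> paths E" "\<nu> \<in> paths E" "g \<in> arrs G"
    "gdom G g = psource E \<nu>" "gcod G g = psource E (v, es)"
    and xe: "x = sp (v, es) \<otimes> u g \<otimes> adj A (sp \<nu>)"
    using x by (auto simp: spanning_def)
  have "s e \<otimes> x = s e \<otimes> (p (tail E e) \<otimes> sp (v, es)) \<otimes> u g \<otimes> adj A (sp \<nu>)"
    using e m s_p[OF e] by (simp add: xe m_assoc[symmetric])
  also have "\<dots> \<in> insert \<zero> spanning"
  proof (cases "tail E e = v")
    case True
    have "s e \<otimes> (p (tail E e) \<otimes> sp (v, es)) = sp (head E e, e # es)"
      using e m True by (simp add: p_sp sp_Cons)
    then show ?thesis using e m True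
      by (intro insertI2 spanningI[of "(head E e, e # es)" \<nu> g]) (auto simp: path_Cons psource_Cons)
  qed (use e m in \<open>simp add: p_mult_sp\<close>)
  finally show ?thesis .
qed

text \<open>If the first path begins with an edge, the adjoint of \<open>s e\<close> cancels that
  edge or kills the product. If it is a vertex, the adjoint has to pass \<open>u g\<close>: with
  \<open>h\<close> inverse to \<open>g\<close>, the product is the adjoint of
  \<open>u h \<otimes> s e\<close>, and the new edge joins the second path.\<close>

lemma s_adj_spanning:
  assumes e: "e \<in> arcs E" and x: "x \<in> spanning"
  shows "adj A (s e) \<otimes> x \<in> insert \<zero> spanning"
proof -
  obtain v es g w fs where m: "(v, es) \<in> paths E" "(w, fs) \<in> paths E" "g \<in> arrs G"
    "gdom G g = psource E (w, fs)" "gcod G g = psource E (v, es)"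
    and xe: "x = sp (v, es) \<otimes> u g \<otimes> adj A (sp (w, fs))"
    using x by (auto simp: spanning_def)
  show ?thesis
  proof (cases es)
    case (Cons f es')
    then have f: "f \<in> arcs E" "head E f = v" "(tail E f, es') \<in> paths E" using m by (simp_all add: path_Cons)
    have "adj A (s e) \<otimes> x = ((adj A (s e) \<otimes> s f) \<otimes> sp (tail E f, es')) \<otimes> u g \<otimes> adj A (sp (w, fs))"
      using e f m by (simp add: xe Cons sp_Cons m_assoc)
    also have "\<dots> \<in> insert \<zero> spanning"
    proof (cases "e = f")
      case True
      then have "(adj A (s e) \<otimes> s f) \<otimes> sp (tail E f, es') = sp (tail E f, es')"
        using e f by (simp add: s_adj_s p_sp)
      then show ?thesis using f m Cons
        by (intro insertI2 spanningI[of "(tail E f, es')" "(w, fs)" g]) (auto simp: psource_Cons)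
    qed (use e f m in \<open>simp add: s_adj_s\<close>)
    finally show ?thesis .
  next
    case Nil
    have v: "v = gcod G g" using m Nil by (simp add: psource_def)
    obtain h where h: "h \<in> arrs G" "gdom G h = gcod G g" "gcod G h = gdom G g" "adj A (u g) = u h"
      using u_adj[OF m(3)] .
    have ug: "u g = adj A (u h)" using h m by (metis adj_adj u_closed)
    have "adj A (s e) \<otimes> x = adj A (s e) \<otimes> (p v \<otimes> u g) \<otimes> adj A (sp (w, fs))"
      using e m(1-3) Nil by (simp add: xe v m_assoc)
    also have "p v \<otimes> u g = adj A (u h)"
      unfolding v p_u[OF m(3)] by (rule ug)
    also have "adj A (s e) \<otimes> adj A (u h) = adj A (u h \<otimes> s e)"
      using e h(1) by (simp add: adj_mult)
    also have "adj A (u h \<otimes> s e) \<otimes> adj A (sp (w, fs)) \<in> insert \<zero> spanning"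
    proof (cases "gdom G h = head E e")
      case True
      let ?f = "act_edge E \<phi> h e" and ?k = "restriction E G \<phi> h e"
      note ea = edge_action[OF h(1) e True[symmetric]]
      obtain k where k: "k \<in> arrs G" "gdom G k = gcod G ?k" "gcod G k = gdom G ?k" "adj A (u ?k) = u k"
        using u_adj[OF ea(3)] .
      have snoc: "(w, fs @ [?f]) \<in> paths E" "sp (w, fs @ [?f]) = sp (w, fs) \<otimes> s ?f"
        "psource E (w, fs @ [?f]) = tail E ?f"
        using path_snoc[OF m(2) ea(1)] ea(2) h(3) m(4) by auto
      have "adj A (u h \<otimes> s e) \<otimes> adj A (sp (w, fs)) = u k \<otimes> adj A (sp (w, fs @ [?f]))"
        using e h(1) True ea m(2) k(1) by (simp add: u_s adj_mult k(4) snoc(2) m_assoc)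
      \<comment> \<open>The first path of the result is the vertex \<open>tail E e\<close>, whose
        projection has to appear explicitly.\<close>
      also have "u k = p (tail E e) \<otimes> u k" using p_u[OF k(1)] k ea by simp
      finally show ?thesis using k ea snoc e
        by (intro insertI2 spanningI[of "(tail E e, [])" "(w, fs @ [?f])" k]) (auto simp: path_Nil psource_def)
    qed (use e h(1) m(2) in \<open>simp add: u_s\<close>)
    finally show ?thesis .
  qed
qed

text \<open>Induction along the first path: \<open>u g\<close> passes an edge and becomes
  \<open>u\<close> of the restriction, so \<open>g\<close> must vary in the induction. At the end of
  the path it is composed with the groupoid element found there.\<close>

lemma u_spanning:
  assumes g: "g \<in> arrs G" and x: "x \<in> spanning"
  shows "u g \<otimes> x \<in> insert \<zero> spanning"
proof -
  have "u g \<otimes> (sp (v, es) \<otimes> u h \<otimes> adj A (sp \<nu>)) \<in> insert \<zero> spanning"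
    if "(v, es) \<in> paths E" "\<nu> \<in> paths E" "h \<in> arrs G" "gdom G h = psource E \<nu>" "gcod G h = psource E (v, es)"
      "g \<in> arrs G" for v es h \<nu> g
    using that
  proof (induction es arbitrary: v g)
    case Nil
    then have v: "v = gcod G h" by (simp add: psource_def)
    have "u g \<otimes> (sp (v, []) \<otimes> u h \<otimes> adj A (sp \<nu>)) = (u g \<otimes> u h) \<otimes> adj A (sp \<nu>)"
      using Nil.prems(2,3,6) p_u[of h] by (simp add: v m_assoc)
    also have "\<dots> \<in> insert \<zero> spanning"
    proof (cases "gdom G g = gcod G h")
      case True
      let ?k = "gcomp G g h"
      have k: "?k \<in> arrs G" "gdom G ?k = gdom G h" "gcod G ?k = gcod G g"
        using Nil True comp_in dom_comp cod_comp by auto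
      have "u g \<otimes> u h = sp (gcod G g, []) \<otimes> u ?k"
        using Nil True p_u[OF k(1)] k by (simp add: u_mult)
      then show ?thesis using k Nil
        by (intro insertI2 spanningI[of "(gcod G g, [])" \<nu> ?k]) (auto simp: path_Nil psource_def)
    qed (use Nil in \<open>simp add: u_mult\<close>)
    finally show ?case .
  next
    case (Cons e es)
    then have e: "e \<in> arcs E" "head E e = v" "(tail E e, es) \<in> paths E"
      and src: "gcod G h = psource E (tail E e, es)" by (simp_all add: path_Cons psource_Cons)
    let ?t = "sp (tail E e, es) \<otimes> u h \<otimes> adj A (sp \<nu>)"
    have t: "?t \<in> carrier A" using e Cons.prems(2,3) by simp
    have eq: "u g \<otimes> (sp (v, e # es) \<otimes> u h \<otimes> adj A (sp \<nu>)) = (u g \<otimes> s e) \<otimes> ?t"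
      using e Cons.prems(2,3,6) by (simp add: sp_Cons m_assoc)
    show ?case
    proof (cases "gdom G g = head E e")
      case True
      let ?f = "act_edge E \<phi> g e" and ?k = "restriction E G \<phi> g e"
      note ea = edge_action[OF Cons.prems(6) e(1) True[symmetric]]
      have "u ?k \<otimes> ?t \<in> insert \<zero> spanning"
        using Cons.IH[OF e(3)] Cons.prems src ea by simp
      then have "s ?f \<otimes> (u ?k \<otimes> ?t) \<in> insert \<zero> spanning"
        using s_spanning[OF ea(1)] ea(1) by auto
      then show ?thesis
        unfolding eq using True Cons.prems e ea t by (simp add: u_s m_assoc)
    qed (use eq e Cons.prems(6) t in \<open>simp add: u_s\<close>)
  qed
  then have step: "u g \<otimes> (sp \<mu> \<otimes> u h \<otimes> adj A (sp \<nu>)) \<in> insert \<zero> spanning"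
    if "\<mu> \<in> paths E" "\<nu> \<in> paths E" "h \<in> arrs G" "gdom G h = psource E \<nu>" "gcod G h = psource E \<mu>" for \<mu> \<nu> h
    using that g by (cases \<mu>) blast
  from x obtain \<mu> h \<nu> where "\<mu> \<in> paths E" "\<nu> \<in> paths E" "h \<in> arrs G"
    "gdom G h = psource E \<nu>" "gcod G h = psource E \<mu>" "x = sp \<mu> \<otimes> u h \<otimes> adj A (sp \<nu>)"
    unfolding spanning_def by blast
  then show ?thesis using step by simp
qed

lemma spanning_adj: "x \<in> spanning \<Longrightarrow> adj A x \<in> spanning"
proof -
  assume "x \<in> spanning"
  then obtain \<mu> \<nu> g where m: "\<mu> \<in> paths E" "\<nu> \<in> paths E" "g \<in> arrs G"
    "gdom G g = psource E \<nu>" "gcod G g = psource E \<mu>"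
    and x: "x = sp \<mu> \<otimes> u g \<otimes> adj A (sp \<nu>)"
    by (auto simp: spanning_def)
  obtain h where h: "h \<in> arrs G" "gdom G h = gcod G g" "gcod G h = gdom G g" "adj A (u g) = u h"
    using u_adj[OF m(3)] .
  have "adj A x = sp \<nu> \<otimes> u h \<otimes> adj A (sp \<mu>)"
    using m h by (simp add: x adj_mult adj_adj m_assoc)
  then show ?thesis using m h by (intro spanningI[of \<nu> \<mu> h]) auto
qed

lemma u_in_spanning: "g \<in> arrs G \<Longrightarrow> u g \<in> spanning"
  by (rule spanningI[of "(gcod G g, [])" "(gdom G g, [])" g])
    (auto simp: path_Nil psource_def p_u u_p p_adj)

lemma p_in_spanning: "v \<in> verts E \<Longrightarrow> p v \<in> spanning"
  using u_in_spanning[of "gid G v"] by (simp add: u_id)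

lemma s_in_spanning: "e \<in> arcs E \<Longrightarrow> s e \<in> spanning"
  by (rule spanningI[of "(head E e, [e])" "(tail E e, [])" "gid G (tail E e)"])
    (auto simp: path_Nil path_Cons psource_def sp_Cons s_p p_adj u_id)

text \<open>The left multipliers \<open>L\<close> of the span are closed under products and contain
  the \<open>u g\<close>, the \<open>s e\<close> and the adjoints of the \<open>s e\<close>; hence
  they contain every spanning element.\<close>

lemma spanning_mult:
  assumes x: "x \<in> spanning" and y: "y \<in> spanning"
  shows "x \<otimes> y \<in> cspan A spanning"
proof -
  define L where "L = {a \<in> carrier A. \<forall>y \<in> cspan A spanning. a \<otimes> y \<in> cspan A spanning}"
  have sub: "insert \<zero> spanning \<subseteq> cspan A spanning"
    using cspan_zero cspan_base spanning_closed by auto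
  have basic: "a \<in> L" if "a \<in> carrier A" "\<And>y. y \<in> spanning \<Longrightarrow> a \<otimes> y \<in> insert \<zero> spanning" for a
  proof -
    have "a \<otimes> y \<in> cspan A spanning" if "y \<in> cspan A spanning" for y
      using that by (rule cspan_left_mult[OF spanning_closed \<open>a \<in> carrier A\<close>, rotated])
        (use \<open>\<And>y. y \<in> spanning \<Longrightarrow> a \<otimes> y \<in> insert \<zero> spanning\<close> sub in blast)
    then show ?thesis using that(1) by (simp add: L_def)
  qed
  have mult: "a \<otimes> b \<in> L" if "a \<in> L" "b \<in> L" for a b
    using that cspan_subset[OF spanning_closed] by (auto simp: L_def m_assoc subset_iff)
  have uL: "u g \<in> L" if "g \<in> arrs G" for g
    using that u_spanning by (intro basic) auto
  have pL: "p v \<in> L" if "v \<in> verts E" for v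
    using uL[of "gid G v"] that by (simp add: u_id)
  have sL: "s e \<in> L" "adj A (s e) \<in> L" if "e \<in> arcs E" for e
    using that s_spanning s_adj_spanning by (auto intro!: basic)
  have spL: "sp (v, es) \<in> L \<and> adj A (sp (v, es)) \<in> L" if "(v, es) \<in> paths E" for v es
    using that
  proof (induction es arbitrary: v)
    case (Cons e es)
    then show ?case using mult sL by (auto simp: path_Cons sp_Cons adj_mult)
  qed (auto simp: path_Nil pL p_adj)
  have "x \<in> L" using x spL uL mult by (auto simp: spanning_def)
  then show ?thesis using y sub by (auto simp: L_def)
qed

section \<open>The unit and density of the span\<close>

lemma one_in_cspan: "\<one> \<in> cspan A spanning"
proof -
  have "V \<subseteq> verts E \<Longrightarrow> (\<Oplus>v\<in>V. p v) \<in> cspan A spanning" if "finite V" for V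
    using that
  proof (induction V rule: finite_induct)
    case empty
    then show ?case by (simp add: cspan_zero[OF spanning_closed])
  next
    case (insert v V)
    have "(\<Oplus>v\<in>insert v V. p v) = p v \<oplus> (\<Oplus>v\<in>V. p v)"
      using insert by (intro finsum_insert) auto
    then show ?case using insert
      by (simp add: cspan_add[OF spanning_closed] cspan_base[OF spanning_closed] p_in_spanning)
  qed
  from this[of "verts E"] show ?thesis by (simp add: sum_p)
qed

text \<open>The closed span is a C*-subalgebra containing the generators, so generation makes it all
  of \<open>A\<close>.\<close>

lemma carrier_eq_closed_cspan:
  assumes gen: "cstar_generated_by A (u ` arrs G \<union> p ` verts E \<union> s ` arcs E)"
  shows "carrier A = closed_cspan A spanning"
proof -
  note sc = spanning_closed
  have "cstar_subalgebra (closed_cspan A spanning) A"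
    unfolding closed_cspan_def
    using subring_cspan[OF sc one_in_cspan spanning_mult] cspan_smult[OF sc]
      cspan_adj[OF sc spanning_adj]
    by (rule cstar_subalgebra_closure)
  moreover have "u ` arrs G \<union> p ` verts E \<union> s ` arcs E \<subseteq> closed_cspan A spanning"
  proof -
    have "cspan A spanning \<subseteq> closed_cspan A spanning"
      unfolding closed_cspan_def
      by (rule closure_of_subset)
        (simp add: cstar_topology_def Metric_space.topspace_mtopology[OF metric_space_A] cspan_subset[OF sc])
    moreover have "u ` arrs G \<union> p ` verts E \<union> s ` arcs E \<subseteq> cspan A spanning"
      using u_in_spanning p_in_spanning s_in_spanning by (auto intro: cspan_base[OF sc])
    ultimately show ?thesis by (rule subset_trans[rotated])
  qed
  ultimately show ?thesis
    using gen unfolding cstar_generated_by_def by simp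
qed

end

theorem proposition4p5:
  fixes E :: "('v, 'e) pre_digraph" and G :: "('v, 'g) groupoid"
    and \<phi> :: "'g \<Rightarrow> ('v, 'e) piso"
    and A :: "'a cstar_alg" and u :: "'g \<Rightarrow> 'a" and p :: "'v \<Rightarrow> 'a" and s :: "'e \<Rightarrow> 'a"
  assumes "fin_digraph E" and "without_sources E"
    and "faithful_self_similar_action E G \<phi>"
    and "toeplitz_algebra E G \<phi> A u p s"
  shows "carrier A = closed_cspan A
    {s_path A p s \<mu> \<otimes>\<^bsub>A\<^esub> u g \<otimes>\<^bsub>A\<^esub> adj A (s_path A p s \<nu>) | \<mu> g \<nu>.
       \<mu> \<in> paths E \<and> \<nu> \<in> paths E \<and> g \<in> arrs G \<and> gdom G g = psource E \<nu> \<and> gcod G g = psource E \<mu>}"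
proof -
  interpret toeplitz_representation E G \<phi> A u p s
    using assms by (simp add: toeplitz_representation_def toeplitz_representation_axioms_def toeplitz_algebra_def)
  show ?thesis
    using carrier_eq_closed_cspan assms(4) by (simp add: toeplitz_algebra_def spanning_def)
qed

end
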